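(* For Tree Augmentation with unit costs (i.e. $c_e=1$ for all $e\in E$), the integrality gap of the Cut-LP is at most $28/15=2-2/15$. That is, for every feasible unit cost instance $T=(V,F),E$, the minimum size of a set $J\subseteq E$ such that $T\cup J$ is $2$-edge-connected is at most $\frac{28}{15}$ times the optimal value of the Cut-LP.
   Context: Tree Augmentation: the input is a tree $T=(V,F)$ and a set $E\subseteq V\times V$ of additional edges (here with unit costs); the goal is a minimum size $J\subseteq E$ such that $T\cup J$ is $2$-edge-connected. For $f\in F$ let $\psi(f)$ be the set of edges $uv\in E$ such that $f$ lies on the unique $uv$-path in $T$. The (unit costs) Cut-LP is: minimize $\sum_{e\in E}x_e$ subject to $\sum_{e\in\psi(f)}x_e\ge1$ for all $f\in F$ and $x_e\ge0$ for all $e\in E$. *)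

theory Defs
  imports Complex_Main
begin

section \<open>Finite undirected multigraphs\<close>

text \<open>
  Edges have their own identity, so parallel edges and loops are possible: an edge of the tree and
  an additional edge with the same endpoints must count as two edges of \<open>T \<union> J\<close>.
\<close>

record ('v, 'e) multigraph =
  mverts :: "'v set"
  medges :: "'e set"
  mends  :: "'e \<Rightarrow> 'v set"

definition wf_multigraph :: "('v, 'e) multigraph \<Rightarrow> bool" where
  "wf_multigraph G \<longleftrightarrow> finite (mverts G) \<and> finite (medges G) \<and>
     (\<forall>e\<in>medges G. \<exists>u\<in>mverts G. \<exists>v\<in>mverts G. mends G e = {u, v})"

text \<open>
  \<open>is_walk G [v\<^sub>0, \<dots>, v\<^sub>k] [e\<^sub>1, \<dots>, e\<^sub>k]\<close>: every \<open>e\<^sub>i\<close> is an edge with ends \<open>v\<^sub>i\<^sub>-\<^sub>1\<close> and \<open>v\<^sub>i\<close>.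
\<close>

fun is_walk :: "('v, 'e) multigraph \<Rightarrow> 'v list \<Rightarrow> 'e list \<Rightarrow> bool" where
  "is_walk G [v] [] \<longleftrightarrow> v \<in> mverts G"
| "is_walk G (v # w # vs) (e # es) \<longleftrightarrow>
     v \<in> mverts G \<and> e \<in> medges G \<and> mends G e = {v, w} \<and> is_walk G (w # vs) es"
| "is_walk G _ _ \<longleftrightarrow> False"

definition is_path :: "('v, 'e) multigraph \<Rightarrow> 'v \<Rightarrow> 'v list \<Rightarrow> 'e list \<Rightarrow> 'v \<Rightarrow> bool" where
  "is_path G u vs es v \<longleftrightarrow> is_walk G vs es \<and> hd vs = u \<and> last vs = v \<and> distinct vs"

text \<open>A loop is a cycle of length 1 and two parallel edges form a cycle of length 2.\<close>

definition is_cycle :: "('v, 'e) multigraph \<Rightarrow> 'v list \<Rightarrow> 'e list \<Rightarrow> bool" where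
  "is_cycle G vs es \<longleftrightarrow>
     is_walk G vs es \<and> es \<noteq> [] \<and> hd vs = last vs \<and> distinct (tl vs) \<and> distinct es"

definition graph_connected :: "('v, 'e) multigraph \<Rightarrow> bool" where
  "graph_connected G \<longleftrightarrow> mverts G \<noteq> {} \<and>
     (\<forall>u\<in>mverts G. \<forall>v\<in>mverts G. \<exists>vs es. is_walk G vs es \<and> hd vs = u \<and> last vs = v)"

definition is_tree :: "('v, 'e) multigraph \<Rightarrow> bool" where
  "is_tree G \<longleftrightarrow> wf_multigraph G \<and> graph_connected G \<and> (\<nexists>vs es. is_cycle G vs es)"

definition delete_edges :: "('v, 'e) multigraph \<Rightarrow> 'e set \<Rightarrow> ('v, 'e) multigraph" where
  "delete_edges G S = G\<lparr>medges := medges G - S\<rparr>"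

text \<open>The graph with a single vertex is \<open>k\<close>-edge-connected for all \<open>k\<close> under this convention.\<close>

definition edge_connected :: "nat \<Rightarrow> ('v, 'e) multigraph \<Rightarrow> bool" where
  "edge_connected k G \<longleftrightarrow>
     (\<forall>S. S \<subseteq> medges G \<and> finite S \<and> card S < k \<longrightarrow> graph_connected (delete_edges G S))"


section \<open>Tree Augmentation\<close>

text \<open>
  Tree edges are sets of two vertices (acyclicity excludes loops). An additional
  edge \<open>uv\<close> is a pair \<open>(u, v)\<close>; only its
  unordered set of ends ever matters.
\<close>

definition base_graph :: "'v set \<Rightarrow> 'v set set \<Rightarrow> ('v, 'v set) multigraph" where
  "base_graph V F = \<lparr>mverts = V, medges = F, mends = id\<rparr>"

definition augmented_graph ::
    "'v set \<Rightarrow> 'v set set \<Rightarrow> ('v \<times> 'v) set \<Rightarrow> ('v, 'v set + 'v \<times> 'v) multigraph" where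
  "augmented_graph V F J =
     \<lparr>mverts = V, medges = F <+> J, mends = case_sum id (\<lambda>(u, v). {u, v})\<rparr>"

definition tap_instance :: "'v set \<Rightarrow> 'v set set \<Rightarrow> ('v \<times> 'v) set \<Rightarrow> bool" where
  "tap_instance V F E \<longleftrightarrow> is_tree (base_graph V F) \<and> E \<subseteq> V \<times> V"

definition tap_solutions :: "'v set \<Rightarrow> 'v set set \<Rightarrow> ('v \<times> 'v) set \<Rightarrow> ('v \<times> 'v) set set" where
  "tap_solutions V F E = {J. J \<subseteq> E \<and> edge_connected 2 (augmented_graph V F J)}"

definition tap_feasible :: "'v set \<Rightarrow> 'v set set \<Rightarrow> ('v \<times> 'v) set \<Rightarrow> bool" where
  "tap_feasible V F E \<longleftrightarrow> tap_solutions V F E \<noteq> {}"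

definition tap_opt :: "'v set \<Rightarrow> 'v set set \<Rightarrow> ('v \<times> 'v) set \<Rightarrow> nat" where
  "tap_opt V F E = Min (card ` tap_solutions V F E)"


section \<open>The Cut-LP with unit costs\<close>

definition tree_path :: "'v set \<Rightarrow> 'v set set \<Rightarrow> 'v \<Rightarrow> 'v \<Rightarrow> 'v set list" where
  "tree_path V F u v = (THE es. \<exists>vs. is_path (base_graph V F) u vs es v)"

definition psi :: "'v set \<Rightarrow> 'v set set \<Rightarrow> ('v \<times> 'v) set \<Rightarrow> 'v set \<Rightarrow> ('v \<times> 'v) set" where
  "psi V F E f = {(u, v) \<in> E. f \<in> set (tree_path V F u v)}"

definition cut_lp_feasible ::
    "'v set \<Rightarrow> 'v set set \<Rightarrow> ('v \<times> 'v) set \<Rightarrow> ('v \<times> 'v \<Rightarrow> real) \<Rightarrow> bool" where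
  "cut_lp_feasible V F E x \<longleftrightarrow>
     (\<forall>f\<in>F. (\<Sum>e\<in>psi V F E f. x e) \<ge> 1) \<and> (\<forall>e\<in>E. x e \<ge> 0)"

definition cut_lp_value :: "'v set \<Rightarrow> 'v set set \<Rightarrow> ('v \<times> 'v) set \<Rightarrow> real" where
  "cut_lp_value V F E = Inf {\<Sum>e\<in>E. x e | x. cut_lp_feasible V F E x}"

end

theory Submission
  imports Defs
begin

text \<open>
  Rooting the tree turns every tree edge into the set of vertices below it. These sets form a
  laminar family, an edge covers a tree edge iff it separates the corresponding set, and contracting
  covered tree edges amounts to deleting sets from the family. Let \<open>L\<close> be the set of minimal members
  (leaves) and \<open>\<delta>\<close> the total degree, with respect to the fractional solution, of the vertices outside
  the leaves; one may assume that every leaf has degree 1. Choose a maximum matching \<open>M\<close> of leaves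
  among the links whose ends are not the only two leaves of some member (twins).

  A greedy contraction covers the family by at most \<open>|L| - |M|/3 + 2\<delta>/3\<close> links. Think of a budget of
  \<open>5/3\<close> per matched pair, 1 per unmatched leaf and \<open>2/3\<close> of its degree per remaining vertex. A minimal
  member that is compatible with the matching and has no link leaving it from an unmatched leaf can
  be covered by its matching edges and one link per unmatched leaf. The cut constraints guarantee that
  the budget leaves 1 for the contracted leaf, except if the member has three leaves, exactly
  two of them matched, and outside its leaves total degree less than \<open>1/2\<close>. In this case the matching edge can
  be exchanged so that the newly unmatched leaf has a link leaving the largest such member, and
  all these members cease to be candidates.

  The maximality of \<open>M\<close> gives \<open>|L| \<le> 4|M| + 4\<delta>\<close>, hence the bound is at most \<open>14/15\<close> of the sum of all
  degrees, which is twice the value of the fractional solution.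
\<close>

section \<open>Weighted laminar families\<close>

definition crosses :: "'a set \<Rightarrow> 'a \<times> 'a \<Rightarrow> bool" where
  "crosses D e \<longleftrightarrow> (fst e \<in> D) \<noteq> (snd e \<in> D)"

locale weighted_links =
  fixes V :: "'a set" and w :: "'a \<Rightarrow> 'a \<Rightarrow> real"
  assumes finite_V: "finite V"
    and w_sym: "w u v = w v u"
    and w_nonneg: "0 \<le> w u v"
begin

text \<open>The sum runs over ordered pairs. Weight between two distinct vertices of
  \<open>A\<close> therefore enters \<open>W A A\<close> twice, and \<open>W V V\<close> is the sum
  of all degrees.\<close>

definition W :: "'a set \<Rightarrow> 'a set \<Rightarrow> real" where
  "W A B = (\<Sum>a\<in>A. \<Sum>b\<in>B. w a b)"

definition links :: "('a \<times> 'a) set" where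
  "links = {(u, v). u \<in> V \<and> v \<in> V \<and> w u v > 0}"

lemma finite_links: "finite links"
  by (rule finite_subset[of _ "V \<times> V"]) (auto simp: links_def finite_V)

lemma W_sym: "W A B = W B A"
  unfolding W_def by (subst sum.swap) (simp add: w_sym)

lemma W_nonneg [simp]: "0 \<le> W A B"
  unfolding W_def by (intro sum_nonneg w_nonneg)

lemma W_mono: "B \<subseteq> C \<Longrightarrow> C \<subseteq> V \<Longrightarrow> W A B \<le> W A C"
  unfolding W_def
  by (intro sum_mono sum_mono2) (auto intro: finite_subset finite_V w_nonneg)

lemma W_diff: "B \<subseteq> C \<Longrightarrow> C \<subseteq> V \<Longrightarrow> W A (C - B) = W A C - W A B"
  unfolding W_def
  by (subst sum_subtractf[symmetric], intro sum.cong refl sum_diff)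
    (auto intro: finite_subset finite_V)

lemma W_Union:
  "(\<And>B. B \<in> \<B> \<Longrightarrow> B \<subseteq> V) \<Longrightarrow> (\<And>B C. B \<in> \<B> \<Longrightarrow> C \<in> \<B> \<Longrightarrow> B \<noteq> C \<Longrightarrow> B \<inter> C = {})
    \<Longrightarrow> W A (\<Union>\<B>) = (\<Sum>B\<in>\<B>. W A B)"
  unfolding W_def
  by (subst sum.swap, intro sum.cong refl sum.Union_disjoint[unfolded o_def])
    (blast intro: finite_subset[OF _ finite_V])+

lemma W_pos_iff:
  assumes "A \<subseteq> V" "B \<subseteq> V"
  shows "W A B > 0 \<longleftrightarrow> (\<exists>a\<in>A. \<exists>b\<in>B. w a b > 0)"
proof -
  have fin: "finite A" "finite B"
    using assms finite_V finite_subset by auto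
  have "W A B = 0 \<longleftrightarrow> (\<forall>a\<in>A. \<forall>b\<in>B. w a b = 0)"
    unfolding W_def using fin
    by (simp add: sum_nonneg_eq_0_iff sum_nonneg w_nonneg)
  moreover have pos: "0 < x \<longleftrightarrow> x \<noteq> 0" if "0 \<le> x" for x :: real
    using that by linarith
  ultimately show ?thesis
    by (simp add: pos[OF W_nonneg] pos[OF w_nonneg])
qed

end

locale laminar_cuts = weighted_links V w for V :: "'a set" and w +
  fixes \<F> :: "'a set set"
  assumes subset_V: "D \<in> \<F> \<Longrightarrow> D \<subseteq> V"
    and laminar: "D \<in> \<F> \<Longrightarrow> G \<in> \<F> \<Longrightarrow> D \<subseteq> G \<or> G \<subseteq> D \<or> D \<inter> G = {}"
    and cut_ge_1: "D \<in> \<F> \<Longrightarrow> 1 \<le> W D (V - D)"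
begin

definition leaves :: "'a set set" where
  "leaves = {A \<in> \<F>. \<forall>B\<in>\<F>. \<not> B \<subset> A}"

definition leaves_in :: "'a set \<Rightarrow> 'a set set" where
  "leaves_in X = {A \<in> leaves. A \<subseteq> X}"

definition rest :: "'a set" where
  "rest = V - \<Union>leaves"

lemma finite_F: "finite \<F>"
  by (rule finite_subset[of _ "Pow V"]) (use subset_V finite_V in auto)

lemma leaf_F: "A \<in> leaves \<Longrightarrow> A \<in> \<F>"
  by (simp add: leaves_def)

lemma leaf_subset_V: "A \<in> leaves \<Longrightarrow> A \<subseteq> V"
  using leaf_F subset_V by blast

lemma finite_leaves: "finite leaves"
  by (rule finite_subset[OF _ finite_F]) (auto simp: leaves_def)

lemma finite_leaves_in: "finite (leaves_in X)"
  by (rule finite_subset[OF _ finite_leaves]) (auto simp: leaves_in_def)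

lemma F_nonempty: "D \<in> \<F> \<Longrightarrow> D \<noteq> {}"
  using cut_ge_1[of D] by (auto simp: W_def)

lemma V_notin_F: "V \<notin> \<F>"
  using cut_ge_1[of V] by (auto simp: W_def)

lemma leaf_nonempty: "A \<in> leaves \<Longrightarrow> A \<noteq> {}"
  using leaf_F F_nonempty by blast

lemma leaf_cases: "A \<in> leaves \<Longrightarrow> D \<in> \<F> \<Longrightarrow> A \<subseteq> D \<or> A \<inter> D = {}"
  using laminar[of A D] by (auto simp: leaves_def)

lemma leaves_disjoint: "A \<in> leaves \<Longrightarrow> B \<in> leaves \<Longrightarrow> A \<noteq> B \<Longrightarrow> A \<inter> B = {}"
  using leaf_cases[of A B] by (auto simp: leaves_def)

lemma leaves_in_nonempty:
  assumes "D \<in> \<F>"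
  shows "leaves_in D \<noteq> {}"
proof -
  have "finite {G \<in> \<F>. G \<subseteq> D}" "{G \<in> \<F>. G \<subseteq> D} \<noteq> {}"
    using finite_F assms by auto
  from finite_has_minimal[OF this] obtain A where A: "A \<in> {G \<in> \<F>. G \<subseteq> D}"
    and min: "\<forall>G\<in>{G \<in> \<F>. G \<subseteq> D}. G \<le> A \<longrightarrow> A = G" ..
  have "\<not> B \<subset> A" if "B \<in> \<F>" for B
  proof
    assume "B \<subset> A"
    then have "B \<in> {G \<in> \<F>. G \<subseteq> D}" "B \<le> A" using A that by auto
    with min have "A = B" by blast
    then show False using \<open>B \<subset> A\<close> by simp
  qed
  then have "A \<in> leaves_in D"
    unfolding leaves_in_def leaves_def using A by simp
  then show ?thesis by blast
qed

text \<open>By laminarity and minimality a leaf that meets a member lies inside it, so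
  \<open>X\<close> is the disjoint union of its leaves and of vertices outside all leaves.\<close>

lemma W_split:
  assumes "X \<in> insert V \<F>"
  shows "W B X = W B (rest \<inter> X) + (\<Sum>A\<in>leaves_in X. W B A)"
proof -
  have XV: "X \<subseteq> V" using assms subset_V by auto
  have *: "X - \<Union>(leaves_in X) = rest \<inter> X"
    using assms leaf_cases[of _ X] leaf_subset_V XV unfolding rest_def leaves_in_def by blast
  have "W B (\<Union>(leaves_in X)) = (\<Sum>A\<in>leaves_in X. W B A)"
    by (rule W_Union) (use leaf_subset_V leaves_disjoint in \<open>auto simp: leaves_in_def\<close>)
  moreover have "W B (X - \<Union>(leaves_in X)) = W B X - W B (\<Union>(leaves_in X))"
    by (rule W_diff) (use XV in \<open>auto simp: leaves_in_def\<close>)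
  ultimately show ?thesis using * by simp
qed

lemma W_V: "D \<in> \<F> \<Longrightarrow> W B V = W B D + W B (V - D)"
  using W_diff[of D V B] subset_V by simp

lemma W_leaf_cut: "A \<in> leaves \<Longrightarrow> W A (V - A) = W A V - W A A"
  using W_V[OF leaf_F, of A A] by simp

section \<open>Pairings of leaves, and covering below a minimal semi-closed set\<close>

definition pairing :: "'a set set set \<Rightarrow> bool" where
  "pairing P \<longleftrightarrow>
     (\<forall>e\<in>P. \<exists>A B. e = {A, B} \<and> A \<noteq> B \<and> A \<in> leaves \<and> B \<in> leaves \<and> W A B > 0) \<and>
     (\<forall>e\<in>P. \<forall>e'\<in>P. e \<noteq> e' \<longrightarrow> e \<inter> e' = {})"

text \<open>
  In \<^term>\<open>semi_closed P X\<close> the set \<^term>\<open>X\<close> is a member of the family or \<^term>\<open>V\<close>, which stands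
  for the whole tree.
\<close>

definition semi_closed :: "'a set set set \<Rightarrow> 'a set \<Rightarrow> bool" where
  "semi_closed P X \<longleftrightarrow>
     (\<forall>e\<in>P. \<Union>e \<subseteq> X \<or> \<Union>e \<inter> X = {}) \<and> (\<forall>A\<in>leaves_in X - \<Union>P. W A (V - X) = 0)"

lemma pairing_elim:
  assumes "pairing P" "e \<in> P"
  obtains A B where "e = {A, B}" "A \<noteq> B" "A \<in> leaves" "B \<in> leaves" "W A B > 0"
proof -
  have "\<exists>A B. e = {A, B} \<and> A \<noteq> B \<and> A \<in> leaves \<and> B \<in> leaves \<and> W A B > 0"
    using assms(1)[unfolded pairing_def, THEN conjunct1, rule_format, OF assms(2)] .
  then show thesis using that by (elim exE conjE)
qed

lemma pairing_disjoint: "pairing P \<Longrightarrow> e \<in> P \<Longrightarrow> e' \<in> P \<Longrightarrow> e \<noteq> e' \<Longrightarrow> e \<inter> e' = {}"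
  unfolding pairing_def by simp

lemma pairing_leaves: "pairing P \<Longrightarrow> e \<in> P \<Longrightarrow> e \<subseteq> leaves"
  by (erule (1) pairing_elim) simp

lemma finite_pairing: "pairing P \<Longrightarrow> finite P"
  by (rule finite_subset[of _ "Pow leaves"]) (use pairing_leaves finite_leaves in auto)

lemma pairing_card: "pairing P \<Longrightarrow> e \<in> P \<Longrightarrow> card e = 2"
  by (erule (1) pairing_elim) simp

lemma pairing_inside:
  assumes "pairing P" "e \<in> P" shows "\<Union>e \<subseteq> X \<longleftrightarrow> e \<subseteq> leaves_in X"
  using pairing_leaves[OF assms] unfolding leaves_in_def by auto

lemma card_Union_pairing:
  assumes "pairing P" "Q \<subseteq> P"
  shows "card (\<Union>Q) = 2 * card Q"
proof -
  have "card (\<Union>Q) = sum card Q"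
  proof (rule card_Union_disjoint)
    show "pairwise disjnt Q"
      using pairing_disjoint[OF assms(1)] assms(2) by (intro pairwiseI) (simp add: disjnt_def subsetD)
    show "finite A" if "A \<in> Q" for A
      using pairing_leaves[OF assms(1), of A] that assms(2) finite_subset[OF _ finite_leaves] by blast
  qed
  also have "\<dots> = (\<Sum>e\<in>Q. 2)"
    by (rule sum.cong) (use assms pairing_card in auto)
  finally show ?thesis by simp
qed

text \<open>One link per pair inside \<open>D\<close> and one per unmatched leaf of \<open>D\<close>
  suffice: a member strictly inside \<open>D\<close> that none of them crosses would itself be
  semi-closed, against minimality. A pair accounts for two leaves but one link, which is the saving
  in the bound.\<close>

lemma minimal_semi_closed_cover:
  assumes P: "pairing P" and D: "D \<in> insert V \<F>" and semi: "semi_closed P D"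
    and minimal: "\<And>G. G \<in> \<F> \<Longrightarrow> G \<subset> D \<Longrightarrow> \<not> semi_closed P G"
  shows "\<exists>J \<subseteq> links. (\<forall>G\<in>\<F>. G \<subset> D \<longrightarrow> (\<exists>j\<in>J. crosses G j)) \<and>
           card J + card {e \<in> P. \<Union>e \<subseteq> D} \<le> card (leaves_in D)"
proof -
  define PD where "PD = {e \<in> P. \<Union>e \<subseteq> D}"
  define UD where "UD = leaves_in D - \<Union>P"
  have "\<exists>j. j \<in> links \<and> (\<exists>A B. e = {A, B} \<and> A \<noteq> B \<and> fst j \<in> A \<and> snd j \<in> B)" if e: "e \<in> P" for e
  proof -
    obtain A B where AB: "e = {A, B}" "A \<noteq> B" "A \<in> leaves" "B \<in> leaves" "W A B > 0"
      using pairing_elim[OF P e] .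
    obtain a b where ab: "a \<in> A" "b \<in> B" "w a b > 0"
      using W_pos_iff[OF leaf_subset_V[OF AB(3)] leaf_subset_V[OF AB(4)]] AB(5) by blast
    have "(a, b) \<in> links"
      using ab leaf_subset_V[OF AB(3)] leaf_subset_V[OF AB(4)] unfolding links_def by blast
    then have "(a, b) \<in> links \<and> (\<exists>A B. e = {A, B} \<and> A \<noteq> B \<and> fst (a, b) \<in> A \<and> snd (a, b) \<in> B)"
      using AB(1,2) ab by (intro conjI exI[of _ A] exI[of _ B]) simp_all
    then show ?thesis by (rule exI)
  qed
  then obtain pl where pl: "\<And>e. e \<in> P \<Longrightarrow>
      pl e \<in> links \<and> (\<exists>A B. e = {A, B} \<and> A \<noteq> B \<and> fst (pl e) \<in> A \<and> snd (pl e) \<in> B)"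
    by metis
  \<comment> \<open>The members containing a leaf \<open>A\<close> form a chain, and a link from \<open>A\<close> crosses an initial segment
    of it. So the link maximising \<open>h A\<close> crosses every member that some link from \<open>A\<close> crosses.\<close>
  define h where "h A j = card {G \<in> \<F>. A \<subseteq> G \<and> snd j \<notin> G}" for A and j :: "'a \<times> 'a"
  have "\<exists>j. j \<in> links \<and> fst j \<in> A \<and> (\<forall>i\<in>links. fst i \<in> A \<longrightarrow> h A i \<le> h A j)"
    if A: "A \<in> leaves" for A
  proof -
    define S where "S = {j \<in> links. fst j \<in> A}"
    have "W A (V - A) > 0" using cut_ge_1[OF leaf_F[OF A]] by linarith
    then obtain a b where ab: "a \<in> A" "b \<in> V" "w a b > 0"
      using W_pos_iff[of A "V - A"] leaf_subset_V[OF A] by blast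
    then have "(a, b) \<in> S"
      unfolding S_def links_def using leaf_subset_V[OF A] by auto
    then have ne: "S \<noteq> {}" and fin: "finite (h A ` S)"
      using finite_links unfolding S_def by auto
    then obtain j where "j \<in> S" "h A j = Max (h A ` S)"
      using Max_in[OF fin] by fastforce
    then show ?thesis
      unfolding S_def using fin Max_ge[OF fin] S_def by (intro exI[of _ j]) auto
  qed
  then obtain up where up: "\<And>A. A \<in> leaves \<Longrightarrow> up A \<in> links"
      "\<And>A. A \<in> leaves \<Longrightarrow> fst (up A) \<in> A"
      "\<And>A i. A \<in> leaves \<Longrightarrow> i \<in> links \<Longrightarrow> fst i \<in> A \<Longrightarrow> h A i \<le> h A (up A)"
    by metis
  define J where "J = pl ` PD \<union> up ` UD"
  have "J \<subseteq> links"
    using pl up(1) unfolding J_def PD_def UD_def leaves_in_def by auto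
  moreover have "\<exists>j\<in>J. crosses G j" if G: "G \<in> \<F>" "G \<subset> D" for G
  proof (rule ccontr)
    assume no: "\<not> (\<exists>j\<in>J. crosses G j)"
    \<comment> \<open>The link chosen for \<open>e\<close> does not cross \<open>G\<close>, and each
      of its two leaves lies inside or outside \<open>G\<close> as a whole.\<close>
    have 1: "\<Union>e \<subseteq> G \<or> \<Union>e \<inter> G = {}" if e: "e \<in> P" for e
    proof (cases "\<Union>e \<subseteq> D")
      case True
      then have "pl e \<in> J" using e unfolding J_def PD_def by blast
      then have "\<not> crosses G (pl e)" using no by blast
      moreover obtain A B where "e = {A, B}" "fst (pl e) \<in> A" "snd (pl e) \<in> B"
        using pl[OF e] by blast
      moreover have "A \<in> leaves" "B \<in> leaves"
        using pairing_leaves[OF P e] calculation by auto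
      ultimately show ?thesis
        using leaf_cases[OF _ G(1)] unfolding crosses_def by blast
    next
      case False
      then show ?thesis using semi e G(2) unfolding semi_closed_def by blast
    qed
    have 2: "W A (V - G) = 0" if A: "A \<in> leaves_in G - \<Union>P" for A
    proof (rule ccontr)
      assume "W A (V - G) \<noteq> 0"
      then have pos: "W A (V - G) > 0" using W_nonneg[of A "V - G"] by linarith
      have Al: "A \<in> leaves" and AG: "A \<subseteq> G" using A by (auto simp: leaves_in_def)
      obtain a y where ay: "a \<in> A" "y \<in> V - G" "w a y > 0"
        using W_pos_iff[of A "V - G"] pos leaf_subset_V[OF Al] by blast
      have "up A \<in> J"
        using A G(2) unfolding J_def UD_def leaves_in_def by auto
      then have inG: "snd (up A) \<in> G"
        using no up(2)[OF Al] AG unfolding crosses_def by blast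
      have "(a, y) \<in> links"
        using ay leaf_subset_V[OF Al] unfolding links_def by auto
      then have "h A (a, y) \<le> h A (up A)"
        using up(3)[OF Al, of "(a, y)"] ay by simp
      \<comment> \<open>A link from \<open>A\<close> leaving \<open>G\<close>, while
        \<open>up A\<close> ends inside \<open>G\<close>, would cross every member around
        \<open>A\<close> that \<open>up A\<close> crosses and \<open>G\<close> in addition, so
        \<open>up A\<close> would not maximise \<open>h A\<close>.\<close>
      moreover have "{H \<in> \<F>. A \<subseteq> H \<and> snd (up A) \<notin> H} \<subset> {H \<in> \<F>. A \<subseteq> H \<and> y \<notin> H}"
      proof
        show "{H \<in> \<F>. A \<subseteq> H \<and> snd (up A) \<notin> H} \<subseteq> {H \<in> \<F>. A \<subseteq> H \<and> y \<notin> H}"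
        proof clarify
          fix H assume H: "H \<in> \<F>" "A \<subseteq> H" "snd (up A) \<notin> H" "y \<in> H"
          have "\<not> H \<inter> G = {}" using H(2) AG leaf_nonempty[OF Al] by blast
          then show False using laminar[OF H(1) G(1)] H inG ay(2) by blast
        qed
        show "{H \<in> \<F>. A \<subseteq> H \<and> snd (up A) \<notin> H} \<noteq> {H \<in> \<F>. A \<subseteq> H \<and> y \<notin> H}"
          using G(1) AG inG ay(2) by blast
      qed
      then have "h A (up A) < h A (a, y)"
        unfolding h_def snd_conv by (rule psubset_card_mono[rotated]) (simp add: finite_F)
      ultimately show False by simp
    qed
    have "semi_closed P G" unfolding semi_closed_def using 1 2 by blast
    then show False using minimal[OF G] by blast
  qed
  moreover have "card J + card PD \<le> card (leaves_in D)"
  proof -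
    have PDP: "PD \<subseteq> P" by (auto simp: PD_def)
    have finPD: "finite PD" using finite_subset[OF PDP finite_pairing[OF P]] .
    have "card J \<le> card PD + card UD"
      unfolding J_def using card_Un_le[of "pl ` PD" "up ` UD"] card_image_le[OF finPD, of pl]
        card_image_le[of UD up] finite_leaves_in[of D] by (simp add: UD_def)
    moreover have "leaves_in D = UD \<union> \<Union>PD"
    proof (intro equalityI subsetI)
      fix A assume A: "A \<in> leaves_in D"
      show "A \<in> UD \<union> \<Union>PD"
      proof (cases "A \<in> \<Union>P")
        case True
        then obtain e where e: "e \<in> P" "A \<in> e" by blast
        have "A \<subseteq> \<Union>e \<inter> D" "A \<noteq> {}"
          using A e(2) leaf_nonempty by (auto simp: leaves_in_def)
        then have "\<Union>e \<subseteq> D" using semi e(1) unfolding semi_closed_def by blast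
        then show ?thesis using e unfolding PD_def by blast
      qed (simp add: UD_def A)
    next
      fix A assume "A \<in> UD \<union> \<Union>PD"
      then show "A \<in> leaves_in D"
        using pairing_inside[OF P, of _ D] unfolding UD_def PD_def by auto
    qed
    moreover have "card (UD \<union> \<Union>PD) = card UD + card (\<Union>PD)"
    proof (rule card_Un_disjoint)
      show "finite UD" "finite (\<Union>PD)"
        using finite_leaves_in[of D] calculation(2) by simp_all
      show "UD \<inter> \<Union>PD = {}" unfolding UD_def PD_def by blast
    qed
    ultimately show ?thesis
      using card_Union_pairing[OF P PDP] by simp
  qed
  ultimately show ?thesis unfolding PD_def by blast
qed

lemma W_split_left:
  assumes "X \<in> insert V \<F>"
  shows "W X B = W (rest \<inter> X) B + (\<Sum>A\<in>leaves_in X. W A B)"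
  using W_split[OF assms, of B] by (simp add: W_sym[of _ B])

subsection \<open>Sets with three leaves\<close>

text \<open>Write \<open>Q\<close> for \<open>rest \<inter> X\<close>. If \<open>W a c = 0\<close>,
  the cut of \<open>a\<close> and the bound on \<open>b\<close> give
  \<open>W b c + W b (V - X) \<le> W a Q\<close>. If \<open>W b (V - X) = 0\<close>, the cut of
  \<open>X\<close> and the bound on \<open>c\<close> give
  \<open>W a c + W b c \<le> W Q (V - X)\<close>. Inserted into the cut of \<open>G\<close>, either
  estimate yields \<open>1 \<le> 2 * W Q V\<close>.\<close>

lemma three_leaves_twin:
  assumes X: "X \<in> \<F>" and lv: "leaves_in X = {a, b, c}"
    and dist: "a \<noteq> b" "a \<noteq> c" "b \<noteq> c"
    and light: "W b (V - b) \<le> 1" "W c (V - c) \<le> 1"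
    and closed: "W a (V - X) = 0"
    and G: "G \<in> \<F>" "a \<union> b \<subseteq> G" "\<not> c \<subseteq> G"
    and bound: "W a c = 0 \<or> W b (V - X) = 0"
  shows "1 / 2 \<le> W (rest \<inter> X) V"
proof -
  have leaf: "a \<in> leaves" "b \<in> leaves" "c \<in> leaves" and sub: "a \<subseteq> X" "b \<subseteq> X" "c \<subseteq> X"
    using lv unfolding leaves_in_def by auto
  have GX: "G \<subseteq> X"
    using laminar[OF G(1) X] G(2,3) sub leaf_nonempty[OF leaf(1)] by blast
  have lvG: "leaves_in G = {a, b}"
    using lv GX G(2,3) unfolding leaves_in_def by blast
  have XV: "X \<subseteq> V" using subset_V X by blast
  \<comment> \<open>\<open>G\<close> divides the vertices of \<open>X\<close> outside the leaves;
    weight between the two parts belongs to the cut of \<open>G\<close>.\<close>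
  define Q1 Q2 Q where "Q1 = rest \<inter> G" and "Q2 = rest \<inter> X - rest \<inter> G" and "Q = rest \<inter> X"
  have Q: "W Y Q = W Y Q1 + W Y Q2" for Y
    using W_diff[of "rest \<inter> G" "rest \<inter> X" Y] Int_mono[OF order_refl GX, of rest] le_infI2[OF XV, of rest]
    unfolding Q1_def Q2_def Q_def by simp
  have Ql: "W Q Y = W Q1 Y + W Q2 Y" for Y
    using Q W_sym by metis
  have WX: "W Y X = W Y Q1 + W Y Q2 + W Y a + W Y b + W Y c" for Y
    using W_split[of X Y] X lv dist Q[of Y] unfolding Q_def by simp
  have WXl: "W X Y = W Q1 Y + W Q2 Y + W a Y + W b Y + W c Y" for Y
    using WX W_sym by metis
  have WG: "W Y G = W Y Q1 + W Y a + W Y b" for Y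
    using W_split[of G Y] G lvG dist unfolding Q1_def by simp
  have WGl: "W G Y = W Q1 Y + W a Y + W b Y" for Y
    using WG W_sym by metis
  have WV: "W Y V = W Y Q1 + W Y Q2 + W Y a + W Y b + W Y c + W Y (V - X)" for Y
    using W_V[OF X, of Y] WX by simp
  have WV_G: "W Y (V - G) = W Y Q2 + W Y c + W Y (V - X)" for Y
    using W_V[OF G(1), of Y] WV WG by simp
  have "1 \<le> W a Q1 + W a Q2 + W a b + W a c"
    using cut_ge_1[OF leaf_F[OF leaf(1)]] unfolding W_leaf_cut[OF leaf(1)] WV closed by simp
  moreover have "W b Q1 + W b Q2 + W a b + W b c + W b (V - X) \<le> 1"
    using light(1) unfolding W_leaf_cut[OF leaf(2)] WV by (simp add: W_sym[of b a])
  moreover have "W c Q1 + W c Q2 + W a c + W b c + W c (V - X) \<le> 1"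
    using light(2) unfolding W_leaf_cut[OF leaf(3)] WV by (simp add: W_sym[of c a] W_sym[of c b])
  moreover have "1 \<le> W Q1 (V - X) + W Q2 (V - X) + W b (V - X) + W c (V - X)"
    using cut_ge_1[OF X] unfolding WXl closed by simp
  moreover have "1 \<le> W Q1 Q2 + W Q1 c + W Q1 (V - X) + W a Q2 + W a c + W b Q2 + W b c + W b (V - X)"
    using cut_ge_1[OF G(1)] unfolding WGl WV_G closed by simp
  moreover have "W Q V = W Q1 Q1 + W Q1 Q2 + W a Q1 + W b Q1 + W Q1 c + W Q1 (V - X) +
      (W Q2 Q1 + W Q2 Q2 + W a Q2 + W b Q2 + W c Q2 + W Q2 (V - X))"
    unfolding Ql WV by (simp add: W_sym[of _ a] W_sym[of _ b] W_sym[of Q2 c])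
  moreover have nn: "0 \<le> W A B" for A B by simp
  moreover note nn[of Q1 Q1] nn[of Q1 Q2] nn[of a Q1] nn[of b Q1] nn[of Q1 c] nn[of Q1 "V - X"]
    nn[of Q2 Q1] nn[of Q2 Q2] nn[of a Q2] nn[of b Q2] nn[of c Q2] nn[of Q2 "V - X"] nn[of a b]
    nn[of b c] nn[of a c] nn[of b "V - X"] nn[of c "V - X"] nn[of c Q1]
  ultimately show ?thesis
    using bound unfolding Q_def[symmetric] by (elim disjE) linarith+
qed

text \<open>This prepares the exchange of a matched pair \<open>{b, c}\<close> for
  \<open>{a, y}\<close>: the freed leaf \<open>z\<close> has weight leaving \<open>X\<close>, and no
  member contains the new pair without \<open>z\<close>.\<close>

lemma three_leaves_swap:
  assumes X: "X \<in> \<F>" and lv: "leaves_in X = {a, b, c}"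
    and dist: "a \<noteq> b" "a \<noteq> c" "b \<noteq> c"
    and light: "W b (V - b) \<le> 1" "W c (V - c) \<le> 1"
    and closed: "W a (V - X) = 0"
    and small: "W (rest \<inter> X) V < 1 / 2"
  shows "\<exists>y z. {y, z} = {b, c} \<and> W a y > 0 \<and> W z (V - X) > 0 \<and> (\<forall>G\<in>\<F>. a \<union> y \<subseteq> G \<longrightarrow> z \<subseteq> G)"
proof -
  define swap where
    "swap y z \<longleftrightarrow> W a y > 0 \<and> W z (V - X) > 0 \<and> (\<forall>G\<in>\<F>. a \<union> y \<subseteq> G \<longrightarrow> z \<subseteq> G)" for y z
  define Q where "Q = rest \<inter> X"
  have leaf: "a \<in> leaves" "b \<in> leaves" "c \<in> leaves"
    using lv unfolding leaves_in_def by auto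
  have pos: "0 < W A B \<longleftrightarrow> W A B \<noteq> 0" for A B
    using W_nonneg[of A B] by linarith
  have WX: "W Y X = W Y Q + W Y a + W Y b + W Y c" for Y
    using W_split[of X Y] X lv dist unfolding Q_def by simp
  have WXl: "W X Y = W Q Y + W a Y + W b Y + W c Y" for Y
    using WX W_sym by metis
  have WV: "W Y V = W Y Q + W Y a + W Y b + W Y c + W Y (V - X)" for Y
    using W_V[OF X, of Y] WX by simp
  have "1 \<le> W a Q + W a b + W a c"
    using cut_ge_1[OF leaf_F[OF leaf(1)]] unfolding W_leaf_cut[OF leaf(1)] WV closed by simp
  moreover have "W b Q + W a b + W b c + W b (V - X) \<le> 1"
    using light(1) unfolding W_leaf_cut[OF leaf(2)] WV by (simp add: W_sym[of b a])
  moreover have "W c Q + W a c + W b c + W c (V - X) \<le> 1"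
    using light(2) unfolding W_leaf_cut[OF leaf(3)] WV by (simp add: W_sym[of c a] W_sym[of c b])
  moreover have "1 \<le> W Q (V - X) + W b (V - X) + W c (V - X)"
    using cut_ge_1[OF X] unfolding WXl closed by simp
  moreover have "W Q V = W Q Q + W a Q + W b Q + W c Q + W Q (V - X)"
    unfolding WV by (simp add: W_sym[of _ a] W_sym[of _ b] W_sym[of Q c])
  moreover have nn: "0 \<le> W A B" for A B by simp
  moreover note nn[of Q Q] nn[of a Q] nn[of b Q] nn[of c Q] nn[of Q "V - X"]
    nn[of a b] nn[of b c] nn[of a c] nn[of b "V - X"] nn[of c "V - X"]
  \<comment> \<open>One of the two choices of \<open>y\<close> has both links that it needs: each of
    the four ways in which both could fail forces degree at least 1 on \<open>Q\<close>.\<close>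
  ultimately have no_twin: "\<not> ((W a b = 0 \<or> W c (V - X) = 0) \<and> (W a c = 0 \<or> W b (V - X) = 0))"
    using small unfolding Q_def[symmetric] by (intro notI, elim conjE disjE) linarith+
  have twin_b: "W a c \<noteq> 0 \<and> W b (V - X) \<noteq> 0" if "G \<in> \<F>" "a \<union> b \<subseteq> G" "\<not> c \<subseteq> G" for G
    using three_leaves_twin[OF X lv dist light closed that] small by linarith
  have lv': "leaves_in X = {a, c, b}" using lv by auto
  have twin_c: "W a b \<noteq> 0 \<and> W c (V - X) \<noteq> 0" if "G \<in> \<F>" "a \<union> c \<subseteq> G" "\<not> b \<subseteq> G" for G
    using three_leaves_twin[OF X lv' dist(2,1) dist(3)[symmetric] light(2,1) closed that] small
    by linarith
  define twin where "twin y z \<longleftrightarrow> (\<exists>G\<in>\<F>. a \<union> y \<subseteq> G \<and> \<not> z \<subseteq> G)" for y z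
  have swap_iff: "swap y z \<longleftrightarrow> W a y \<noteq> 0 \<and> W z (V - X) \<noteq> 0 \<and> \<not> twin y z" for y z
    unfolding swap_def twin_def pos by auto
  \<comment> \<open>Members through \<open>a\<close> that contain \<open>b\<close> but not
    \<open>c\<close>, and \<open>c\<close> but not \<open>b\<close>, would cross. So at most one
    choice is blocked by a twin, and then \<open>three_leaves_twin\<close> provides the links for
    the other choice.\<close>
  have "\<not> (twin b c \<and> twin c b)"
    unfolding twin_def using laminar leaf_nonempty[OF leaf(1)] by blast
  moreover have "twin b c \<Longrightarrow> W a c \<noteq> 0 \<and> W b (V - X) \<noteq> 0"
    using twin_b unfolding twin_def by auto
  moreover have "twin c b \<Longrightarrow> W a b \<noteq> 0 \<and> W c (V - X) \<noteq> 0"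
    using twin_c unfolding twin_def by auto
  ultimately have "swap b c \<or> swap c b"
    unfolding swap_iff using no_twin by argo
  then show ?thesis
    unfolding swap_def[symmetric]
  proof
    assume "swap b c"
    then show "\<exists>y z. {y, z} = {b, c} \<and> swap y z" by (intro exI[of _ b] exI[of _ c]) simp
  next
    assume "swap c b"
    then show "\<exists>y z. {y, z} = {b, c} \<and> swap y z"
      by (intro exI[of _ c] exI[of _ b]) (simp add: insert_commute)
  qed
qed

section \<open>Degree that a member must have outside its leaves\<close>

text \<open>The cut weight of a leaf of \<open>D\<close> can only go to
  \<open>rest \<inter> D\<close>, and the cut weight of \<open>D\<close> can only come from there.
  These are two separate contributions of at least 1.\<close>

lemma closed_leaves_credit:
  assumes D: "D \<in> \<F>"
    and closed: "\<And>A. A \<in> leaves_in D \<Longrightarrow> W A (V - D) = 0"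
    and indep: "\<And>A B. A \<in> leaves_in D \<Longrightarrow> B \<in> leaves_in D \<Longrightarrow> A \<noteq> B \<Longrightarrow> W A B = 0"
  shows "2 \<le> W (rest \<inter> D) V"
proof -
  define Q where "Q = rest \<inter> D"
  obtain A where A: "A \<in> leaves_in D" using leaves_in_nonempty[OF D] by blast
  then have leaf: "A \<in> leaves" by (simp add: leaves_in_def)
  have sumA: "(\<Sum>B\<in>leaves_in D. W A B) = W A A"
    using sum.mono_neutral_right[OF finite_leaves_in, of "{A}" D "W A"] A indep[OF A] by force
  have "1 \<le> W A Q"
    using cut_ge_1[OF leaf_F[OF leaf]] W_split[of D A] W_V[OF D, of A] D closed[OF A]
    unfolding W_leaf_cut[OF leaf] sumA Q_def by simp
  moreover have "1 \<le> W Q (V - D)"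
    using cut_ge_1[OF D] W_split_left[of D "V - D"] D closed unfolding Q_def by simp
  moreover have "W Q V = W Q D + W Q (V - D)" by (rule W_V[OF D])
  moreover have "W A Q \<le> W Q D"
    using W_mono[of A D Q] A subset_V[OF D] by (simp add: W_sym[of A Q] leaves_in_def)
  ultimately show ?thesis unfolding Q_def by linarith
qed

text \<open>The cuts of \<open>u\<close>, \<open>v\<close> and \<open>D\<close> together demand
  weight 3. Of this, \<open>b\<close> and \<open>c\<close> supply at most 1 each, and what remains
  falls on \<open>rest \<inter> D\<close>.\<close>

lemma one_pair_credit:
  assumes D: "D \<in> \<F>"
    and bc: "b \<in> leaves_in D" "c \<in> leaves_in D" "b \<noteq> c"
    and light: "W b (V - b) \<le> 1" "W c (V - c) \<le> 1"
    and u: "{u, v} \<subseteq> leaves_in D - {b, c}" "u \<noteq> v"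
    and closed: "\<And>A. A \<in> leaves_in D - {b, c} \<Longrightarrow> W A (V - D) = 0"
    and indep: "\<And>A B. A \<in> leaves_in D - {b, c} \<Longrightarrow> B \<in> leaves_in D - {b, c} \<Longrightarrow>
                  A \<noteq> B \<Longrightarrow> W A B = 0"
  shows "1 \<le> W (rest \<inter> D) V"
proof -
  define Q where "Q = rest \<inter> D"
  have split: "W Y D = W Y Q + (\<Sum>A\<in>leaves_in D. W Y A)" for Y
    using W_split[of D Y] D unfolding Q_def by simp
  have leaf: "b \<in> leaves" "c \<in> leaves" "u \<in> leaves" "v \<in> leaves"
    using bc u unfolding leaves_in_def by auto
  have lower: "(\<Sum>A\<in>S. W Y A) \<le> (\<Sum>A\<in>leaves_in D. W Y A)" if "S \<subseteq> leaves_in D" for S Y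
    by (rule sum_mono2[OF finite_leaves_in that]) simp
  have free: "1 \<le> W A Q + W A b + W A c" if A: "A \<in> leaves_in D - {b, c}" for A
  proof -
    have "(\<Sum>B\<in>leaves_in D. W A B) = (\<Sum>B\<in>{A, b, c}. W A B)"
      using A bc(1,2) indep[OF A] by (intro sum.mono_neutral_right finite_leaves_in) auto
    also have "\<dots> = W A A + W A b + W A c" using A bc(3) by simp
    finally have "W A V = W A Q + (W A A + W A b + W A c)"
      using W_V[OF D, of A] split[of A] closed[OF A] by simp
    moreover have "A \<in> leaves" using A by (simp add: leaves_in_def)
    ultimately show ?thesis
      using cut_ge_1[OF leaf_F] W_leaf_cut[of A] by fastforce
  qed
  have matched: "W A u + W A v + W A (V - D) \<le> 1"
    if A: "A \<in> {b, c}" for A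
  proof -
    have "(\<Sum>B\<in>{A, u, v}. W A B) \<le> (\<Sum>B\<in>leaves_in D. W A B)"
      by (rule lower) (use A bc u in auto)
    moreover have "(\<Sum>B\<in>{A, u, v}. W A B) = W A A + W A u + W A v"
    proof -
      have "A \<noteq> u" "A \<noteq> v" using A u(1) by blast+
      then show ?thesis using u(2) by simp
    qed
    moreover have "A \<in> leaves" "W A (V - A) \<le> 1" using A leaf light by auto
    ultimately show ?thesis
      using W_V[OF D, of A] split[of A] W_leaf_cut[of A] W_nonneg[of A Q] by linarith
  qed
  have "(\<Sum>A\<in>leaves_in D. W A (V - D)) = (\<Sum>A\<in>{b, c}. W A (V - D))"
    using bc(1,2) closed by (intro sum.mono_neutral_right finite_leaves_in) auto
  then have "1 \<le> W Q (V - D) + W b (V - D) + W c (V - D)"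
    using cut_ge_1[OF D] W_split_left[of D "V - D"] D bc(3) unfolding Q_def by simp
  moreover have "W Q V = W Q D + W Q (V - D)" by (rule W_V[OF D])
  moreover have "W Q u + W Q v \<le> W Q D"
  proof -
    have "(\<Sum>A\<in>{u, v}. W Q A) = W Q u + W Q v" using u(2) by simp
    moreover have "{u, v} \<subseteq> leaves_in D" using u(1) by blast
    ultimately show ?thesis
      using lower[of "{u, v}" Q] split[of Q] W_nonneg[of Q Q] by linarith
  qed
  moreover have "1 \<le> W Q u + W b u + W c u" "1 \<le> W Q v + W b v + W c v"
    using free[of u] free[of v] u by (simp_all add: W_sym[of u] W_sym[of v])
  ultimately show ?thesis
    using matched[of b] matched[of c] unfolding Q_def[symmetric] by simp
qed

section \<open>Deficient members and the exchange of their matched pair\<close>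

text \<open>
  The members whose contraction within the budget fails: three leaves, of which exactly the pair
  \<open>e\<close> is matched.
\<close>

definition deficient :: "'a set set set \<Rightarrow> 'a set set \<Rightarrow> 'a set \<Rightarrow> bool" where
  "deficient P e X \<longleftrightarrow> X \<in> \<F> \<and> e \<subseteq> leaves_in X \<and> card (leaves_in X) = 3 \<and>
     (\<forall>a\<in>leaves_in X - e. a \<notin> \<Union>P \<and> W a (V - X) = 0) \<and> W (rest \<inter> X) V < 1 / 2"

lemma deficientD:
  assumes "deficient P e X"
  shows "X \<in> \<F>" "e \<subseteq> leaves_in X" "card (leaves_in X) = 3" "W (rest \<inter> X) V < 1 / 2"
    "a \<in> leaves_in X - e \<Longrightarrow> a \<notin> \<Union>P" "a \<in> leaves_in X - e \<Longrightarrow> W a (V - X) = 0"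
  using assms unfolding deficient_def by (elim conjE, blast)+

lemma leaves_in_mono: "X \<subseteq> Y \<Longrightarrow> leaves_in X \<subseteq> leaves_in Y"
  unfolding leaves_in_def by auto

lemma pairing_nonempty: "pairing P \<Longrightarrow> e \<in> P \<Longrightarrow> e \<noteq> {}"
  by (erule (1) pairing_elim) simp

text \<open>If the two sets met, one would contain the other. The larger would then contain a leaf
  matched by a foreign pair, whereas its only leaf outside its own pair is unmatched.\<close>

lemma deficient_nested:
  assumes P: "pairing P" and e: "e \<in> P" "deficient P e X" and e': "e' \<in> P" "deficient P e' X'"
    and meet: "X \<inter> X' \<noteq> {}"
  shows "e = e'"
proof (rule ccontr)
  assume ne: "e \<noteq> e'"
  have *: False if d: "d \<in> P" "d' \<in> P" "d \<noteq> d'" "deficient P d Y" "deficient P d' Y'" "Y \<subseteq> Y'" for d d' Y Y'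
  proof -
    have "d \<subseteq> leaves_in Y'"
      using deficientD(2)[OF d(4)] leaves_in_mono[OF d(6)] by (rule subset_trans)
    moreover have "d \<inter> d' = {}" by (rule pairing_disjoint[OF P d(1,2,3)])
    moreover obtain A where A: "A \<in> d" using pairing_nonempty[OF P d(1)] by blast
    ultimately have A': "A \<in> leaves_in Y' - d'" "A \<in> \<Union>P" using d(1) by blast+
    show False using deficientD(5)[OF d(5) A'(1)] A'(2) ..
  qed
  have "X \<subseteq> X' \<or> X' \<subseteq> X"
    using laminar[OF deficientD(1)[OF e(2)] deficientD(1)[OF e'(2)]] meet by simp
  then show False using *[OF e(1) e'(1) ne e(2) e'(2)] *[OF e'(1) e(1) ne[symmetric] e'(2) e(2)] by blast
qed

text \<open>All deficient sets of \<open>e\<close> contain the leaves of \<open>e\<close>, so they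
  form a chain.\<close>

lemma deficient_top:
  assumes "deficient P e X0" "e \<noteq> {}"
  shows "\<exists>X. deficient P e X \<and> (\<forall>X'. deficient P e X' \<longrightarrow> X' \<subseteq> X)"
proof -
  have fin: "finite {X. deficient P e X}"
    by (rule finite_subset[OF _ finite_F]) (auto simp: deficient_def)
  have "{X. deficient P e X} \<noteq> {}" using assms(1) by auto
  from finite_has_maximal[OF fin this] obtain X where X: "X \<in> {X. deficient P e X}"
    and max: "\<forall>Y\<in>{X. deficient P e X}. X \<subseteq> Y \<longrightarrow> X = Y" ..
  have "X' \<subseteq> X" if X': "deficient P e X'" for X'
  proof -
    obtain A where "A \<in> e" using assms(2) by blast
    then have "A \<in> leaves_in X" "A \<in> leaves_in X'"
      using deficientD(2)[of P e] X X' by blast+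
    then have "X \<inter> X' \<noteq> {}"
      using leaf_nonempty[of A] unfolding leaves_in_def by blast
    then have "X \<subseteq> X' \<or> X' \<subseteq> X"
      using laminar[OF deficientD(1) deficientD(1)[OF X'], of P e X] X by simp
    then show ?thesis using max X' by blast
  qed
  then show ?thesis using X by blast
qed

text \<open>This is \<open>three_leaves_swap\<close> with the unmatched third leaf in the role of
  \<open>a\<close>.\<close>

lemma deficient_swap:
  assumes P: "pairing P" and e: "e \<in> P" and X: "deficient P e X"
    and light: "\<And>A. A \<in> e \<Longrightarrow> W A (V - A) \<le> 1"
  shows "\<exists>a y z. leaves_in X = {a, y, z} \<and> e = {y, z} \<and> a \<notin> \<Union>P \<and> a \<noteq> y \<and>
           W a (V - X) = 0 \<and> W a y > 0 \<and> W z (V - X) > 0 \<and> (\<forall>G\<in>\<F>. a \<union> y \<subseteq> G \<longrightarrow> z \<subseteq> G)"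
proof -
  obtain b c where bc: "e = {b, c}" "b \<noteq> c" using pairing_elim[OF P e] .
  have "card (leaves_in X - e) = 1"
    using X card_Diff_subset[of e "leaves_in X"] bc by (simp add: deficient_def)
  then obtain a where a: "leaves_in X - e = {a}" by (meson card_1_singletonE)
  have sub: "e \<subseteq> leaves_in X" using X by (simp add: deficient_def)
  have lv: "leaves_in X = {a, b, c}"
    using a bc(1) sub by blast
  have aP: "a \<notin> \<Union>P" "W a (V - X) = 0"
    using a X unfolding deficient_def by simp_all
  have ne: "a \<noteq> b" "a \<noteq> c" using a bc(1) by blast+
  obtain y z where yz: "{y, z} = {b, c}" "W a y > 0" "W z (V - X) > 0"
      "\<forall>G\<in>\<F>. a \<union> y \<subseteq> G \<longrightarrow> z \<subseteq> G"
    using three_leaves_swap[OF deficientD(1)[OF X] lv ne bc(2) _ _ aP(2) deficientD(4)[OF X]]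
      light bc(1) by (elim meta_impE) (simp_all, metis)
  have "(y = b \<and> z = c) \<or> (y = c \<and> z = b)"
    using yz(1) by (simp add: doubleton_eq_iff)
  then have "leaves_in X = {a, y, z}" "e = {y, z}" "a \<noteq> y"
    using lv bc(1) ne by (elim disjE; simp add: insert_commute)+
  then show ?thesis using aP yz(2-) by (intro exI conjI)
qed

subsection \<open>Greedy contraction\<close>

lemma pairingI:
  assumes "\<And>e. e \<in> P \<Longrightarrow> \<exists>A B. e = {A, B} \<and> A \<noteq> B \<and> A \<in> leaves \<and> B \<in> leaves \<and> W A B > 0"
    and "\<And>e e'. e \<in> P \<Longrightarrow> e' \<in> P \<Longrightarrow> e \<noteq> e' \<Longrightarrow> e \<inter> e' = {}"
  shows "pairing P"
  unfolding pairing_def by (intro conjI ballI impI assms)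

text \<open>The added pairs may be twins; what counts is that no weight remains between two
  unmatched leaves.\<close>

lemma maximal_pairing:
  assumes M: "pairing M"
  shows "\<exists>P. pairing P \<and> M \<subseteq> P \<and>
    (\<forall>A\<in>leaves - \<Union>P. \<forall>B\<in>leaves - \<Union>P. A \<noteq> B \<longrightarrow> W A B = 0)"
proof -
  have fin: "finite {P. pairing P \<and> M \<subseteq> P}"
    by (rule finite_subset[of _ "Pow (Pow leaves)"]) (use pairing_leaves finite_leaves in auto)
  have "{P. pairing P \<and> M \<subseteq> P} \<noteq> {}" using M by blast
  from finite_has_maximal[OF fin this] obtain P where P: "P \<in> {P. pairing P \<and> M \<subseteq> P}"
    and max: "\<forall>Q\<in>{P. pairing P \<and> M \<subseteq> P}. P \<subseteq> Q \<longrightarrow> P = Q" ..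
  then have pP: "pairing P" and MP: "M \<subseteq> P" by auto
  have "W A B = 0" if A: "A \<in> leaves - \<Union>P" and B: "B \<in> leaves - \<Union>P" and ne: "A \<noteq> B" for A B
  proof (rule ccontr)
    assume "W A B \<noteq> 0"
    then have pos: "W A B > 0" using W_nonneg[of A B] by linarith
    have disj: "{A, B} \<inter> e = {}" if "e \<in> P" for e using A B that by blast
    have "pairing (insert {A, B} P)"
    proof (rule pairingI)
      fix e assume e: "e \<in> insert {A, B} P"
      show "\<exists>A B. e = {A, B} \<and> A \<noteq> B \<and> A \<in> leaves \<and> B \<in> leaves \<and> W A B > 0"
      proof (cases "e \<in> P")
        case True
        then show ?thesis by (rule pairing_elim[OF pP]) (intro exI conjI)
      next
        case False
        then show ?thesis using e A B ne pos by (intro exI[of _ A] exI[of _ B]) simp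
      qed
    next
      fix e e' assume "e \<in> insert {A, B} P" "e' \<in> insert {A, B} P" "e \<noteq> e'"
      then show "e \<inter> e' = {}"
        using disj[of e] disj[of e'] pairing_disjoint[OF pP, of e e'] by (metis inf_commute insertE)
    qed
    then have "P = insert {A, B} P" using max MP by blast
    then have "{A, B} \<in> P" by blast
    then show False using disj by blast
  qed
  then show ?thesis using pP MP by blast
qed

lemma semi_closed_V: "pairing P \<Longrightarrow> semi_closed P V"
  unfolding semi_closed_def using pairing_leaves leaf_subset_V by (fastforce simp: W_def)

lemma finite_minimal_exists:
  fixes S :: "'b set set"
  assumes "finite S" "x \<in> S" "Q x"
  shows "\<exists>D\<in>S. Q D \<and> (\<forall>G\<in>S. G \<subset> D \<longrightarrow> \<not> Q G)"
proof -
  have fin: "finite {X \<in> S. Q X}" and ne: "{X \<in> S. Q X} \<noteq> {}" using assms by auto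
  from finite_has_minimal[OF this] obtain D where D: "D \<in> {X \<in> S. Q X}"
    and min: "\<forall>G\<in>{X \<in> S. Q X}. G \<subseteq> D \<longrightarrow> D = G" ..
  then show ?thesis by (intro bexI[of _ D]) auto
qed

lemma compatible_subset:
  assumes P: "pairing P" and e: "e \<in> P" and D: "D \<in> insert V \<F>" and semi: "semi_closed P D"
    and A: "A \<in> e" "A \<subseteq> D"
  shows "e \<subseteq> leaves_in D"
proof -
  have "A \<in> leaves" using pairing_leaves[OF P e] A by blast
  then have "\<Union>e \<inter> D \<noteq> {}" using A leaf_nonempty by blast
  then have "\<Union>e \<subseteq> D" using semi e unfolding semi_closed_def by blast
  then show ?thesis using pairing_inside[OF P e] by blast
qed

text \<open>
  The inequality says that the links in \<open>J\<close> are paid for by the budget inside \<open>D\<close>, where one unit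
  must remain for the new leaf \<open>D\<close>, unless everything is covered (\<open>D = V\<close>).
\<close>

definition contractible :: "'a set set set \<Rightarrow> 'a set \<Rightarrow> ('a \<times> 'a) set \<Rightarrow> bool" where
  "contractible M D J \<longleftrightarrow> D \<in> insert V \<F> \<and> D \<notin> leaves \<and> J \<subseteq> links \<and>
     (\<forall>G\<in>\<F>. G \<subset> D \<longrightarrow> (\<exists>j\<in>J. crosses G j)) \<and>
     (\<forall>e\<in>M. \<Union>e \<subseteq> D \<or> \<Union>e \<inter> D = {}) \<and>
     real (card J) + card {e \<in> M. \<Union>e \<subseteq> D} / 3 + (if D = V then 0 else 1)
       \<le> card (leaves_in D) + 2 / 3 * W (rest \<inter> D) V"

text \<open>\<open>M\<close> is extended to a maximal pairing \<open>P0\<close>, pairs with a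
  deficient set are exchanged, and \<open>D\<close> is a minimal semi-closed set for the result
  \<open>P\<close>. A pair of \<open>N\<close> saves a full link; a pair of \<open>M\<close> saves
  only 2/3, because 1/3 of it already occurs in the bound.\<close>

lemma contractible_exists:
  assumes M: "pairing M"
    and light: "\<And>A. A \<in> \<Union>M \<Longrightarrow> W A (V - A) \<le> 1"
    and no_twin: "\<And>e G. e \<in> M \<Longrightarrow> G \<in> \<F> \<Longrightarrow> leaves_in G \<noteq> e"
  shows "\<exists>D J. contractible M D J"
proof -
  obtain P0 where P0: "pairing P0" "M \<subseteq> P0"
    and indep: "\<forall>A\<in>leaves - \<Union>P0. \<forall>B\<in>leaves - \<Union>P0. A \<noteq> B \<longrightarrow> W A B = 0"
    using maximal_pairing[OF M] by blast
  define N where "N = P0 - M"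
  define Def where "Def e \<longleftrightarrow> (\<exists>X. deficient P0 e X)" for e
  have "\<exists>X. Def e \<longrightarrow> deficient P0 e X \<and> (\<forall>X'. deficient P0 e X' \<longrightarrow> X' \<subseteq> X)" if "e \<in> M" for e
    using deficient_top[OF _ pairing_nonempty[OF M that], of P0] unfolding Def_def
    by (cases "\<exists>X. deficient P0 e X") auto
  then obtain T where T: "\<And>e. e \<in> M \<Longrightarrow> Def e \<Longrightarrow> deficient P0 e (T e)"
      "\<And>e X. e \<in> M \<Longrightarrow> deficient P0 e X \<Longrightarrow> X \<subseteq> T e"
    unfolding Def_def by metis
  \<comment> \<open>\<open>T e\<close> is the largest deficient set of \<open>e\<close>, with third leaf \<open>a\<close>. Replacing \<open>e = {y, z}\<close> by
    \<open>{a, y}\<close> leaves \<open>z\<close> unmatched, and \<open>z\<close> has a link leaving \<open>T e\<close>, hence leaving all deficient sets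
    of \<open>e\<close> at once.\<close>
  define swapped where "swapped e a y z \<longleftrightarrow> leaves_in (T e) = {a, y, z} \<and> e = {y, z} \<and> a \<notin> \<Union>P0 \<and> a \<noteq> y \<and>
      W a (V - T e) = 0 \<and> W a y > 0 \<and> W z (V - T e) > 0 \<and> (\<forall>G\<in>\<F>. a \<union> y \<subseteq> G \<longrightarrow> z \<subseteq> G)" for e a y z
  have "\<exists>a y z. Def e \<longrightarrow> swapped e a y z" if e: "e \<in> M" for e
  proof (cases "Def e")
    case True
    have "\<And>A. A \<in> e \<Longrightarrow> W A (V - A) \<le> 1" using light[OF UnionI[OF e]] .
    from deficient_swap[OF P0(1) subsetD[OF P0(2) e] T(1)[OF e True] this] show ?thesis
      unfolding swapped_def by simp
  qed simp
  then obtain a y z where sw: "\<And>e. e \<in> M \<Longrightarrow> Def e \<Longrightarrow> swapped e (a e) (y e) (z e)"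
    by metis
  have T_F: "T e \<in> \<F>" if "e \<in> M" "Def e" for e
    using deficientD(1)[OF T(1)[OF that]] .
  have T_disj: "T e \<inter> T e' = {}" if "e \<in> M" "Def e" "e' \<in> M" "Def e'" "e \<noteq> e'" for e e'
    using deficient_nested[OF P0(1) _ T(1)[OF that(1,2)] _ T(1)[OF that(3,4)]] that P0(2) by blast
  have lvT: "leaves_in (T e) = {a e, y e, z e}" and e_eq: "e = {y e, z e}"
    and a_P0: "a e \<notin> \<Union>P0" and a_y: "a e \<noteq> y e" and a_closed: "W (a e) (V - T e) = 0"
    and a_y_link: "W (a e) (y e) > 0" and z_open: "W (z e) (V - T e) > 0"
    and no_twin_ay: "\<forall>G\<in>\<F>. a e \<union> y e \<subseteq> G \<longrightarrow> z e \<subseteq> G"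
    if "e \<in> M" "Def e" for e
    using sw[OF that] unfolding swapped_def by simp_all
  have a_T: "a e \<in> leaves_in (T e)" and y_T: "y e \<in> leaves_in (T e)" and z_T: "z e \<in> leaves_in (T e)"
    if "e \<in> M" "Def e" for e
    using lvT[OF that] by simp_all
  have z_in: "z e \<in> e" and y_in: "y e \<in> e" if "e \<in> M" "Def e" for e
    using e_eq[OF that] by blast+
  have y_z: "y e \<noteq> z e" if "e \<in> M" "Def e" for e
  proof
    assume "y e = z e"
    then have "card e = 1" using arg_cong[OF e_eq[OF that], of card] by simp
    then show False using pairing_card[OF M that(1)] by simp
  qed
  have a_leaf: "a e \<in> leaves" "a e \<subseteq> T e" if "e \<in> M" "Def e" for e
    using a_T[OF that] unfolding leaves_in_def by simp_all
  define g where "g e = (if Def e then {a e, y e} else e)" for e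
  have g_sub: "g e \<subseteq> e \<union> (if Def e then {a e} else {})" if "e \<in> M" for e
    using y_in[OF that] unfolding g_def by simp
  have a_inj: "a e \<noteq> a e'" if "e \<in> M" "Def e" "e' \<in> M" "Def e'" "e \<noteq> e'" for e e'
    using T_disj[OF that] a_leaf[OF that(1,2)] a_leaf[OF that(3,4)] leaf_nonempty by blast
  have M_disj: "e \<inter> e' = {}" if "e \<in> P0" "e' \<in> P0" "e \<noteq> e'" for e e'
    using pairing_disjoint[OF P0(1) that] .
  have g_disj: "g e \<inter> g e' = {}" if e: "e \<in> M" and e': "e' \<in> M" and ne: "e \<noteq> e'" for e e'
  proof -
    have "a e \<notin> e'" if "Def e" using a_P0[OF e that] P0(2) e' by blast
    moreover have "a e' \<notin> e" if "Def e'" using a_P0[OF e' that] P0(2) e by blast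
    moreover have "a e \<noteq> a e'" if "Def e" "Def e'" using a_inj[OF e that(1) e' that(2) ne] .
    moreover have "e \<inter> e' = {}" using M_disj P0(2) e e' ne by blast
    ultimately show ?thesis
      using g_sub[OF e] g_sub[OF e'] by (auto split: if_splits)
  qed
  have gN_disj: "g e \<inter> e' = {}" if e: "e \<in> M" and e': "e' \<in> N" for e e'
  proof -
    have "a e \<notin> e'" if "Def e" using a_P0[OF e that] e' unfolding N_def by blast
    moreover have "e \<inter> e' = {}" using M_disj P0(2) e e' unfolding N_def by blast
    ultimately show ?thesis
      using g_sub[OF e] by (auto split: if_splits)
  qed
  define P where "P = g ` M \<union> N"
  have P: "pairing P"
  proof (rule pairingI)
    fix p assume p: "p \<in> P"
    show "\<exists>A B. p = {A, B} \<and> A \<noteq> B \<and> A \<in> leaves \<and> B \<in> leaves \<and> W A B > 0"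
    proof (cases "p \<in> P0")
      case True
      then show ?thesis by (rule pairing_elim[OF P0(1)]) (intro exI conjI)
    next
      case False
      then obtain e where e: "e \<in> M" "p = g e" using p unfolding P_def N_def by blast
      then have "Def e" using False P0(2) unfolding g_def by (auto split: if_splits)
      then have "p = {a e, y e}"
        using e unfolding g_def by simp
      moreover have "a e \<in> leaves" "y e \<in> leaves"
        using a_T[OF e(1) \<open>Def e\<close>] y_T[OF e(1) \<open>Def e\<close>] unfolding leaves_in_def by simp_all
      ultimately show ?thesis
        using a_y[OF e(1) \<open>Def e\<close>] a_y_link[OF e(1) \<open>Def e\<close>]
        by (intro exI[of _ "a e"] exI[of _ "y e"]) simp
    qed
  next
    fix p p' assume p: "p \<in> P" and p': "p' \<in> P" and ne: "p \<noteq> p'"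
    have N_disj: "p \<inter> p' = {}" if "p \<in> N" "p' \<in> N"
      using M_disj that ne unfolding N_def by blast
    from p p' ne show "p \<inter> p' = {}"
      unfolding P_def using N_disj g_disj gN_disj by (elim UnE imageE) (metis inf_commute)+
  qed
  have fin_insert: "finite (insert V \<F>)" using finite_F by simp
  obtain D where D: "D \<in> insert V \<F>" and semi: "semi_closed P D"
    and min: "\<forall>G\<in>insert V \<F>. G \<subset> D \<longrightarrow> \<not> semi_closed P G"
    using finite_minimal_exists[where Q = "semi_closed P", OF fin_insert insertI1 semi_closed_V[OF P]] by blast
  obtain J where J: "J \<subseteq> links" "\<forall>G\<in>\<F>. G \<subset> D \<longrightarrow> (\<exists>j\<in>J. crosses G j)"
    "card J + card {e \<in> P. \<Union>e \<subseteq> D} \<le> card (leaves_in D)"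
    using minimal_semi_closed_cover[OF P D semi] min by blast
  \<comment> \<open>Otherwise \<open>D \<subseteq> T e\<close>. The freed leaf \<open>z e\<close> is
    unmatched and has weight leaving \<open>T e\<close>, so it is not in \<open>D\<close>. Hence all
    leaves of \<open>D\<close> are among \<open>a e\<close> and \<open>y e\<close>, compatibility
    puts both into \<open>D\<close>, and \<open>no_twin_ay\<close> forces \<open>z e\<close> into
    \<open>D\<close> after all.\<close>
  have T_D: "T e \<subset> D \<or> T e \<inter> D = {}" if e: "e \<in> M" "Def e" for e
  proof (rule ccontr)
    assume neg: "\<not> ?thesis"
    have "D \<in> \<F>"
      using D neg T_F[OF e] subset_V V_notin_F by blast
    then have DT: "D \<subseteq> T e" using laminar[OF T_F[OF e]] neg by blast
    have zP: "z e \<notin> \<Union>P"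
    proof
      assume "z e \<in> \<Union>P"
      then obtain p where p: "p \<in> P" "z e \<in> p" by blast
      have ze: "z e \<in> e" by (rule z_in[OF e])
      have "e \<in> P0" using e P0(2) by blast
      have "z e \<noteq> a e" using a_P0[OF e] UnionI[OF \<open>e \<in> P0\<close> ze] by metis
      then have "z e \<notin> g e" using e y_z[OF e] unfolding g_def by simp
      show False
      proof (cases "p \<in> N")
        case True
        then show False using M_disj[of e p] \<open>e \<in> P0\<close> e p(2) ze unfolding N_def by blast
      next
        case False
        then obtain e' where e': "e' \<in> M" "p = g e'" using p(1) unfolding P_def by blast
        then have "e' \<noteq> e" using \<open>z e \<notin> g e\<close> p(2) by blast
        then have "z e \<notin> e'" using M_disj[of e e'] \<open>e \<in> P0\<close> P0(2) e' ze by blast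
        then have "Def e'" "z e = a e'" using g_sub[OF e'(1)] p(2) e'(2) by (auto split: if_splits)
        then show False using a_P0[OF e'(1)] UnionI[OF \<open>e \<in> P0\<close> ze] by simp
      qed
    qed
    have zD: "z e \<notin> leaves_in D"
    proof
      assume "z e \<in> leaves_in D"
      then have "W (z e) (V - D) = 0" using semi zP unfolding semi_closed_def by blast
      moreover have "W (z e) (V - T e) \<le> W (z e) (V - D)" by (rule W_mono) (use DT in auto)
      ultimately show False using z_open[OF e] by linarith
    qed
    have "leaves_in D \<subseteq> {a e, y e}"
      using leaves_in_mono[OF DT] lvT[OF e] zD by blast
    moreover obtain A where A: "A \<in> leaves_in D" using leaves_in_nonempty[OF \<open>D \<in> \<F>\<close>] by blast
    ultimately have "A \<in> g e" "A \<subseteq> D"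
      using e unfolding g_def by (simp add: subset_iff) (use A in \<open>simp add: leaves_in_def\<close>)
    moreover have "g e \<in> P" using e unfolding P_def by blast
    ultimately have "g e \<subseteq> leaves_in D" using compatible_subset[OF P _ D semi] by blast
    then have "a e \<union> y e \<subseteq> D" using e unfolding g_def leaves_in_def by simp
    then have "z e \<subseteq> D" using no_twin_ay[OF e] \<open>D \<in> \<F>\<close> by simp
    then show False using zD z_T[OF e] unfolding leaves_in_def by simp
  qed
  \<comment> \<open>Since \<open>T e\<close> lies strictly inside \<open>D\<close> or apart from it,
    the exchange alters neither the compatibility of the pairs with \<open>D\<close> nor which of
    them lie in \<open>D\<close>. This carries the result for \<open>P\<close> back to
    \<open>M\<close>.\<close>
  have inside: "\<Union>(g e) \<subseteq> D \<longleftrightarrow> \<Union>e \<subseteq> D" and outside: "\<Union>e \<subseteq> D \<or> \<Union>e \<inter> D = {}" if e: "e \<in> M" for e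
  proof -
    have "(\<Union>(g e) \<subseteq> D \<longleftrightarrow> \<Union>e \<subseteq> D) \<and> (\<Union>e \<subseteq> D \<or> \<Union>e \<inter> D = {})"
    proof (cases "Def e")
      case True
      have inT: "a e \<subseteq> T e" "y e \<subseteq> T e" "z e \<subseteq> T e" and leaf: "a e \<noteq> {}" "y e \<noteq> {}"
        using a_T[OF e True] y_T[OF e True] z_T[OF e True] leaf_nonempty
        unfolding leaves_in_def by simp_all
      have "\<Union>(g e) = a e \<union> y e" unfolding g_def using True by simp
      moreover have "\<Union>e = y e \<union> z e" using arg_cong[OF e_eq[OF e True], of Union] by simp
      ultimately have sub: "\<Union>e \<subseteq> T e" "\<Union>(g e) \<subseteq> T e" and ne: "\<Union>e \<noteq> {}" "\<Union>(g e) \<noteq> {}"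
        using inT leaf by simp_all
      show ?thesis using T_D[OF e True] sub ne by blast
    next
      case False
      then have "g e = e" unfolding g_def by simp
      moreover have "g e \<in> P" using e unfolding P_def by blast
      ultimately show ?thesis using semi unfolding semi_closed_def by auto
    qed
    then show "\<Union>(g e) \<subseteq> D \<longleftrightarrow> \<Union>e \<subseteq> D" "\<Union>e \<subseteq> D \<or> \<Union>e \<inter> D = {}" by auto
  qed
  define MD where "MD = {e \<in> M. \<Union>e \<subseteq> D}"
  define ND where "ND = {e \<in> N. \<Union>e \<subseteq> D}"
  have fin: "finite MD" "finite ND"
    using finite_pairing[OF P0(1)] P0(2) unfolding MD_def ND_def N_def
    by (auto intro: finite_subset)
  have card_P: "card {e \<in> P. \<Union>e \<subseteq> D} = card MD + card ND"
  proof -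
    have "{e \<in> P. \<Union>e \<subseteq> D} = g ` MD \<union> ND"
      unfolding P_def MD_def ND_def using inside by blast
    moreover have "card (g ` MD \<union> ND) = card (g ` MD) + card ND"
    proof (rule card_Un_disjoint)
      show "g ` MD \<inter> ND = {}"
      proof (rule ccontr)
        assume "g ` MD \<inter> ND \<noteq> {}"
        then obtain e where e: "e \<in> M" "g e \<in> N" unfolding MD_def ND_def by blast
        then have "g e = {}" using gN_disj[OF e] by blast
        then show False using pairing_nonempty[OF P, of "g e"] e unfolding P_def by blast
      qed
    qed (use fin in auto)
    moreover have "card (g ` MD) = card MD"
    proof (rule card_image, rule inj_onI, rule ccontr)
      fix e e' assume "e \<in> MD" "e' \<in> MD" "g e = g e'" "e \<noteq> e'"
      then have "g e = {}" "e \<in> M" using g_disj[of e e'] unfolding MD_def by auto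
      then show False using pairing_nonempty[OF P, of "g e"] unfolding P_def by blast
    qed
    ultimately show ?thesis by simp
  qed
  \<comment> \<open>A leaf is never semi-closed: if matched, it is cut off from its partner; if
    unmatched, all of its positive cut weight leaves it.\<close>
  have D_leaf: "D \<notin> leaves"
  proof
    assume DL: "D \<in> leaves"
    show False
    proof (cases "D \<in> \<Union>P")
      case True
      then obtain p where p: "p \<in> P" "D \<in> p" by blast
      then have "p \<subseteq> leaves_in D" using compatible_subset[OF P p(1) D semi p(2)] by blast
      moreover have "leaves_in D \<subseteq> {D}" using DL unfolding leaves_in_def leaves_def by auto
      ultimately have "card p \<le> card {D}" by (intro card_mono) auto
      then show False using pairing_card[OF P p(1)] by simp
    next
      case False
      then have "W D (V - D) = 0" using semi DL unfolding semi_closed_def leaves_in_def by blast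
      then show False using cut_ge_1[OF leaf_F[OF DL]] by simp
    qed
  qed
  \<comment> \<open>A leaf that is matched in \<open>P\<close> but not in \<open>P0\<close> is some
    \<open>a e\<close>. Its weight stays within \<open>T e\<close>, which is contained in
    \<open>D\<close>.\<close>
  have unmatched: "W A (V - D) = 0" if A: "A \<in> leaves_in D - \<Union>P0" for A
  proof (cases "A \<in> \<Union>P")
    case False
    then show ?thesis using semi A unfolding semi_closed_def by blast
  next
    case True
    then obtain p where p: "p \<in> P" "A \<in> p" by blast
    then have "p \<notin> N" using A unfolding N_def by blast
    then obtain e where e: "e \<in> M" "p = g e" using p unfolding P_def by blast
    have "A \<notin> e" using A e P0(2) by blast
    then have Ae: "Def e" "A = a e" using g_sub[OF e(1)] p(2) e(2) by (auto split: if_splits)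
    have "T e \<inter> D \<noteq> {}"
      using A a_leaf(1,2)[OF e(1) Ae(1)] leaf_nonempty Ae(2) unfolding leaves_in_def by blast
    then have "T e \<subseteq> D" using T_D[OF e(1) Ae(1)] by blast
    then have "W A (V - D) \<le> W A (V - T e)" by (intro W_mono) auto
    then show ?thesis
      using a_closed[OF e(1) Ae(1)] W_nonneg[of A "V - D"] unfolding Ae(2) by linarith
  qed
  \<comment> \<open>The unit for the new leaf \<open>D\<close> is paid by one pair of
    \<open>N\<close> or by two pairs of \<open>M\<close>. Without any pair the degree outside the
    leaves is at least 2. With a single pair of \<open>M\<close> it is at least 1/2, and
    \<open>2/3 + 2/3 * 1/2 = 1\<close>.\<close>
  have credit: "1 \<le> 2 / 3 * card MD + card ND + 2 / 3 * W (rest \<inter> D) V" if "D \<in> \<F>"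
  proof -
    have indep': "W A B = 0" if "A \<in> leaves_in D - \<Union>P0" "B \<in> leaves_in D - \<Union>P0" "A \<noteq> B" for A B
      using indep that unfolding leaves_in_def by blast
    have in_MN: "A \<in> \<Union>MD \<union> \<Union>ND" if A: "A \<in> leaves_in D" "A \<in> \<Union>P0" for A
    proof -
      obtain e where e: "e \<in> P0" "A \<in> e" using A by blast
      have "\<Union>e \<inter> D \<noteq> {}" using A(1) e(2) leaf_nonempty unfolding leaves_in_def by blast
      moreover have "\<Union>e \<subseteq> D \<or> \<Union>e \<inter> D = {}"
      proof (cases "e \<in> M")
        case True then show ?thesis by (rule outside)
      next
        case False
        then have "e \<in> P" using e unfolding P_def N_def by blast
        then show ?thesis using semi unfolding semi_closed_def by blast
      qed
      ultimately show ?thesis using e unfolding MD_def ND_def N_def by blast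
    qed
    have nn: "0 \<le> W (rest \<inter> D) V" by simp
    consider "card ND \<ge> 1" | "card MD \<ge> 2" | "card ND = 0" "card MD = 0" | "card ND = 0" "card MD = 1"
      by linarith
    then show ?thesis
    proof cases
      case 1
      then have "1 \<le> real (card ND)" by simp
      then show ?thesis using nn by linarith
    next
      case 2
      then have "2 \<le> real (card MD)" by simp
      then show ?thesis using nn by linarith
    next
      case 3
      then have "MD = {}" "ND = {}" using fin by simp_all
      then have "A \<in> leaves_in D - \<Union>P0" if "A \<in> leaves_in D" for A using in_MN that by blast
      then have "2 \<le> W (rest \<inter> D) V"
        using closed_leaves_credit[OF \<open>D \<in> \<F>\<close>] unmatched indep' by blast
      then show ?thesis by simp
    next
      case 4
      then obtain e where MDe: "MD = {e}" by (meson card_1_singletonE)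
      have ND: "ND = {}" using 4 fin by simp
      have e: "e \<in> M" "\<Union>e \<subseteq> D" using MDe unfolding MD_def by auto
      obtain b c where bc: "e = {b, c}" "b \<noteq> c" using pairing_elim[OF M e(1)] .
      have bcD: "b \<in> leaves_in D" "c \<in> leaves_in D"
        using pairing_inside[OF M e(1), of D] e(2) bc(1) by simp_all
      have lightbc: "W b (V - b) \<le> 1" "W c (V - c) \<le> 1" using light[OF UnionI[OF e(1)]] bc(1) by simp_all
      have free: "A \<in> leaves_in D - \<Union>P0" if "A \<in> leaves_in D - {b, c}" for A
        using in_MN that MDe ND bc(1) by blast
      have "1 / 2 \<le> W (rest \<inter> D) V"
      proof (cases "\<exists>u v. {u, v} \<subseteq> leaves_in D - {b, c} \<and> u \<noteq> v")
        case True
        then obtain u v where uv: "{u, v} \<subseteq> leaves_in D - {b, c}" "u \<noteq> v" by blast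
        have "1 \<le> W (rest \<inter> D) V"
          by (rule one_pair_credit[OF \<open>D \<in> \<F>\<close> bcD bc(2) lightbc uv])
            (use unmatched indep' free in blast)+
        then show ?thesis by simp
      next
        case False
        \<comment> \<open>There must be a third leaf since pairs of \<open>M\<close> are not twins.
          If it is the only further leaf and the degree is too small, then \<open>D\<close> is
          deficient and hence contained in \<open>T e\<close>, which \<open>T_D\<close>
          excludes.\<close>
        have "leaves_in D \<noteq> {b, c}" using no_twin[OF e(1) \<open>D \<in> \<F>\<close>] bc by simp
        then obtain u where u: "u \<in> leaves_in D - {b, c}" using bcD by blast
        then have lvD: "leaves_in D = {u, b, c}" "leaves_in D - e = {u}" using False bcD bc(1) by blast+
        show ?thesis
        proof (rule ccontr)
          assume small: "\<not> ?thesis"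
          have "card (leaves_in D) = 3"
            using lvD u bc(2) by simp
          then have "deficient P0 e D"
            unfolding deficient_def using \<open>D \<in> \<F>\<close> bcD bc(1) lvD(2) free[OF u] unmatched[of u] small
            by simp
          then have "D \<subseteq> T e" "Def e" using T(2)[OF e(1)] unfolding Def_def by blast+
          then have "D = {}" using T_D[OF e(1)] by blast
          then show False using F_nonempty \<open>D \<in> \<F>\<close> by blast
        qed
      qed
      then show ?thesis using 4 by simp
    qed
  qed
  have "contractible M D J"
    unfolding contractible_def
  proof (intro conjI ballI)
    have nn: "0 \<le> W (rest \<inter> D) V" by simp
    have "real (card J) + card MD + card ND \<le> card (leaves_in D)"
      using J(3) card_P by linarith
    moreover have "(if D = V then 0 else 1) \<le> 2 / 3 * card MD + card ND + 2 / 3 * W (rest \<inter> D) V"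
      using credit D nn by (cases "D = V") auto
    ultimately show "real (card J) + card {e \<in> M. \<Union>e \<subseteq> D} / 3 + (if D = V then 0 else 1)
       \<le> card (leaves_in D) + 2 / 3 * W (rest \<inter> D) V"
      unfolding MD_def[symmetric] by linarith
  qed (use D D_leaf J(1,2) outside in auto)
  then show ?thesis by blast
qed

section \<open>Contracting a member, and the induction\<close>

lemma leaves_contract:
  assumes D: "D \<in> \<F>" "D \<notin> leaves"
  shows "laminar_cuts V w {G \<in> \<F>. \<not> G \<subset> D}"
    and "laminar_cuts.leaves {G \<in> \<F>. \<not> G \<subset> D} = insert D (leaves - leaves_in D)"
proof -
  show L: "laminar_cuts V w {G \<in> \<F>. \<not> G \<subset> D}"
    by unfold_locales (use subset_V laminar cut_ge_1 in auto)
  show "laminar_cuts.leaves {G \<in> \<F>. \<not> G \<subset> D} = insert D (leaves - leaves_in D)"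
  proof (intro equalityI subsetI)
    fix A assume "A \<in> laminar_cuts.leaves {G \<in> \<F>. \<not> G \<subset> D}"
    then have A: "A \<in> \<F>" "\<not> A \<subset> D" and min: "\<And>B. B \<in> \<F> \<Longrightarrow> \<not> B \<subset> D \<Longrightarrow> \<not> B \<subset> A"
      unfolding laminar_cuts.leaves_def[OF L] by auto
    show "A \<in> insert D (leaves - leaves_in D)"
    proof (cases "A = D")
      case False
      have "\<not> D \<subset> A" using min D by blast
      then have disj: "A \<inter> D = {}" using laminar[OF A(1) D(1)] A(2) False by blast
      have "\<not> B \<subset> A" if B: "B \<in> \<F>" for B
        using min[OF B] disj F_nonempty[OF B] by blast
      then have "A \<in> leaves" using A unfolding leaves_def by blast
      moreover have "A \<notin> leaves_in D" using disj F_nonempty[OF A(1)] unfolding leaves_in_def by blast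
      ultimately show ?thesis by blast
    qed simp
  next
    fix A assume A: "A \<in> insert D (leaves - leaves_in D)"
    have "A \<in> \<F>" "\<not> A \<subset> D" and "\<forall>B\<in>\<F>. \<not> B \<subset> D \<longrightarrow> \<not> B \<subset> A"
      using A D(1) unfolding leaves_def leaves_in_def by auto
    then show "A \<in> laminar_cuts.leaves {G \<in> \<F>. \<not> G \<subset> D}"
      unfolding laminar_cuts.leaves_def[OF L] by blast
  qed
qed

end

text \<open>Induction on the number of members: what lies strictly inside a contractible
  \<open>D\<close> is covered and deleted, and \<open>D\<close> continues as a leaf, paid for by the
  unit reserved in \<open>contractible\<close>. The family shrinks because \<open>D\<close> is not a
  leaf before.\<close>

lemma laminar_cover:
  fixes V :: "'a set"
  assumes "laminar_cuts V w \<F>"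
    and "laminar_cuts.pairing w \<F> M"
    and "\<And>A. A \<in> \<Union>M \<Longrightarrow> weighted_links.W w A (V - A) \<le> 1"
    and "\<And>e G. e \<in> M \<Longrightarrow> G \<in> \<F> \<Longrightarrow> laminar_cuts.leaves_in \<F> G \<noteq> e"
  shows "\<exists>J \<subseteq> weighted_links.links V w. (\<forall>G\<in>\<F>. \<exists>j\<in>J. crosses G j) \<and>
    card J \<le> card (laminar_cuts.leaves \<F>) - card M / 3 + 2 / 3 * weighted_links.W w (laminar_cuts.rest V \<F>) V"
  using assms
proof (induction "card \<F>" arbitrary: \<F> M rule: less_induct)
  case less
  interpret L: laminar_cuts V w \<F> by (rule less.prems(1))
  obtain D J where "L.contractible M D J"
    using L.contractible_exists[OF less.prems(2-4)] by blast
  then have D: "D \<in> insert V \<F>" "D \<notin> L.leaves" and J: "J \<subseteq> L.links"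
    and cov: "\<forall>G\<in>\<F>. G \<subset> D \<longrightarrow> (\<exists>j\<in>J. crosses G j)"
    and comp: "\<forall>e\<in>M. \<Union>e \<subseteq> D \<or> \<Union>e \<inter> D = {}"
    and bound: "real (card J) + card {e \<in> M. \<Union>e \<subseteq> D} / 3 + (if D = V then 0 else 1)
       \<le> card (L.leaves_in D) + 2 / 3 * L.W (L.rest \<inter> D) V"
    unfolding L.contractible_def by simp_all
  show ?case
  proof (cases "D = V")
    case True
    have "\<forall>G\<in>\<F>. \<exists>j\<in>J. crosses G j"
      using cov True L.subset_V L.V_notin_F by blast
    moreover have "{e \<in> M. \<Union>e \<subseteq> V} = M"
      using L.pairing_leaves[OF less.prems(2)] L.leaf_subset_V by blast
    moreover have "L.leaves_in V = L.leaves"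
      using L.leaf_subset_V unfolding L.leaves_in_def by auto
    moreover have "L.rest \<inter> V = L.rest" unfolding L.rest_def by blast
    ultimately show ?thesis using J bound True by (intro exI[of _ J]) simp
  next
    case False
    then have DF: "D \<in> \<F>" using D by blast
    define \<F>' where "\<F>' = {G \<in> \<F>. \<not> G \<subset> D}"
    interpret L': laminar_cuts V w \<F>'
      unfolding \<F>'_def by (rule L.leaves_contract(1)[OF DF D(2)])
    have leaves': "L'.leaves = insert D (L.leaves - L.leaves_in D)"
      unfolding \<F>'_def by (rule L.leaves_contract(2)[OF DF D(2)])
    define M' where "M' = {e \<in> M. \<not> \<Union>e \<subseteq> D}"
    have M'M: "e \<in> M" "e \<inter> L.leaves_in D = {}" if "e \<in> M'" for e
    proof -
      show "e \<in> M" using that unfolding M'_def by simp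
      then have disj: "\<Union>e \<inter> D = {}" using comp that unfolding M'_def by blast
      show "e \<inter> L.leaves_in D = {}"
      proof (rule ccontr)
        assume "e \<inter> L.leaves_in D \<noteq> {}"
        then obtain A where "A \<in> e" "A \<in> L.leaves" "A \<subseteq> D" unfolding L.leaves_in_def by blast
        then show False using disj L.leaf_nonempty by blast
      qed
    qed
    have pairing': "L'.pairing M'"
    proof (rule L'.pairingI)
      fix e assume e: "e \<in> M'"
      obtain A B where "e = {A, B}" "A \<noteq> B" "A \<in> L.leaves" "B \<in> L.leaves" "L.W A B > 0"
        using L.pairing_elim[OF less.prems(2) M'M(1)[OF e]] .
      then show "\<exists>A B. e = {A, B} \<and> A \<noteq> B \<and> A \<in> L'.leaves \<and> B \<in> L'.leaves \<and> L.W A B > 0"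
        using M'M(2)[OF e] unfolding leaves' by (intro exI[of _ A] exI[of _ B]) simp
    next
      fix e e' assume "e \<in> M'" "e' \<in> M'" "e \<noteq> e'"
      then show "e \<inter> e' = {}" by (intro L.pairing_disjoint[OF less.prems(2)] M'M(1))
    qed
    have "card \<F>' < card \<F>"
    proof (rule psubset_card_mono[OF L.finite_F])
      obtain B where "B \<in> \<F>" "B \<subset> D" using D(2) DF unfolding L.leaves_def by blast
      then show "\<F>' \<subset> \<F>" unfolding \<F>'_def by blast
    qed
    \<comment> \<open>Contraction creates no twins in \<open>M'\<close>: a member containing
      \<open>D\<close> now has \<open>D\<close> among its leaves, and \<open>D\<close> is in no
      pair; the leaves of a member disjoint from \<open>D\<close> are unchanged.\<close>
    moreover have "L'.leaves_in G \<noteq> e" if e: "e \<in> M'" and G: "G \<in> \<F>'" for e G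
    proof
      assume eq: "L'.leaves_in G = e"
      have eL: "e \<subseteq> L.leaves_in G"
        using eq L.pairing_leaves[OF less.prems(2) M'M(1)[OF e]]
        unfolding L'.leaves_in_def L.leaves_in_def by blast
      have GF: "G \<in> \<F>" "\<not> G \<subset> D" using G unfolding \<F>'_def by auto
      have "\<not> D \<subseteq> G"
      proof
        assume "D \<subseteq> G"
        then have "D \<in> e" using eq unfolding L'.leaves_in_def leaves' by blast
        then show False using L.pairing_leaves[OF less.prems(2) M'M(1)[OF e]] D(2) by blast
      qed
      then have "G \<inter> D = {}" using L.laminar[OF GF(1) DF] GF(2) by blast
      then have "L.leaves_in G \<subseteq> L'.leaves_in G"
        using L.leaf_nonempty unfolding L'.leaves_in_def L.leaves_in_def leaves' by blast
      then have "L.leaves_in G = e" using eq eL by blast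
      then show False using less.prems(4)[OF M'M(1)[OF e] GF(1)] by blast
    qed
    moreover have "L.W A (V - A) \<le> 1" if "A \<in> \<Union>M'" for A
      using less.prems(3) that M'M(1) by blast
    ultimately obtain J' where J': "J' \<subseteq> L.links" "\<forall>G\<in>\<F>'. \<exists>j\<in>J'. crosses G j"
      "card J' \<le> card L'.leaves - card M' / 3 + 2 / 3 * L.W L'.rest V"
      using less.hyps[OF _ L'.laminar_cuts_axioms pairing'] by blast
    have fin: "finite M" by (rule L.finite_pairing[OF less.prems(2)])
    have sub: "L.leaves_in D \<subseteq> L.leaves" unfolding L.leaves_in_def by simp
    then have "card L'.leaves = 1 + (card L.leaves - card (L.leaves_in D))"
      unfolding leaves' using D(2) L.finite_leaves L.finite_leaves_in by (simp add: card_Diff_subset)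
    moreover have "card (L.leaves_in D) \<le> card L.leaves"
      by (rule card_mono[OF L.finite_leaves sub])
    moreover have "card M = card {e \<in> M. \<Union>e \<subseteq> D} + card M'"
    proof -
      have "M = {e \<in> M. \<Union>e \<subseteq> D} \<union> M'" "{e \<in> M. \<Union>e \<subseteq> D} \<inter> M' = {}"
        unfolding M'_def by blast+
      then show ?thesis using card_Un_disjoint[of "{e \<in> M. \<Union>e \<subseteq> D}" M'] fin
        by (metis finite_Un)
    qed
    moreover have "L.W L'.rest V = L.W L.rest V - L.W (L.rest \<inter> D) V"
    proof -
      have "\<Union>L'.leaves = D \<union> \<Union>L.leaves"
        unfolding leaves' L.leaves_in_def by auto
      then have "L'.rest = L.rest - (L.rest \<inter> D)"
        unfolding L'.rest_def L.rest_def by blast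
      then show ?thesis
        using L.W_diff[of "L.rest \<inter> D" L.rest V] by (simp add: L.W_sym[of _ V] L.rest_def)
    qed
    moreover have "card (J \<union> J') \<le> card J + card J'" by (rule card_Un_le)
    ultimately have "card (J \<union> J') \<le> card L.leaves - card M / 3 + 2 / 3 * L.W L.rest V"
    proof -
      assume "card L'.leaves = 1 + (card L.leaves - card (L.leaves_in D))"
        "card (L.leaves_in D) \<le> card L.leaves" "card M = card {e \<in> M. \<Union>e \<subseteq> D} + card M'"
        "L.W L'.rest V = L.W L.rest V - L.W (L.rest \<inter> D) V" "card (J \<union> J') \<le> card J + card J'"
      moreover from this have "real (card L'.leaves) = 1 + real (card L.leaves) - real (card (L.leaves_in D))"
        by linarith
      moreover have "real (card J) + card {e \<in> M. \<Union>e \<subseteq> D} / 3 + 1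
          \<le> card (L.leaves_in D) + 2 / 3 * L.W (L.rest \<inter> D) V"
        using bound False by simp
      ultimately show ?thesis using J'(3) by linarith
    qed
    moreover have "\<exists>j\<in>J \<union> J'. crosses G j" if "G \<in> \<F>" for G
    proof (cases "G \<subset> D")
      case True
      then show ?thesis using cov that by blast
    next
      case False
      then show ?thesis using J'(2) that unfolding \<F>'_def by blast
    qed
    ultimately show ?thesis using J J'(1) by (intro exI[of _ "J \<union> J'"]) simp
  qed
qed

lemma sum_eq_single:
  fixes f :: "'b \<Rightarrow> 'c::comm_monoid_add"
  assumes "finite S" "a \<in> S" "\<And>x. x \<in> S \<Longrightarrow> x \<noteq> a \<Longrightarrow> f x = 0"
  shows "sum f S = f a"
proof -
  have "sum f (S - {a}) = 0" by (rule sum.neutral) (use assms(3) in blast)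
  then show ?thesis using sum.remove[OF assms(1,2), of f] by simp
qed

section \<open>Families with leaves of unit degree\<close>

locale unit_leaf_cuts = laminar_cuts V w \<F> for V :: "'a set" and w \<F> +
  assumes leaf_unit: "A \<in> leaves \<Longrightarrow> W A V = 1"
    and leaf_inner: "A \<in> leaves \<Longrightarrow> W A A = 0"
begin

section \<open>Pairings without twins\<close>

text \<open>The excluded pairs are the twins, that is, the two only leaves of some member.\<close>

definition plain_link :: "'a set \<Rightarrow> 'a set \<Rightarrow> bool" where
  "plain_link A B \<longleftrightarrow> A \<noteq> B \<and> A \<in> leaves \<and> B \<in> leaves \<and> W A B > 0 \<and> (\<forall>G\<in>\<F>. leaves_in G \<noteq> {A, B})"

definition plain_pairing :: "'a set set set \<Rightarrow> bool" where
  "plain_pairing M \<longleftrightarrow> pairing M \<and> (\<forall>e\<in>M. \<forall>G\<in>\<F>. leaves_in G \<noteq> e)"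

lemma plain_pairing_insert:
  assumes M: "plain_pairing M" and AB: "plain_link A B" and new: "A \<notin> \<Union>M" "B \<notin> \<Union>M"
  shows "plain_pairing (insert {A, B} M)"
proof -
  have pM: "pairing M" and tM: "\<forall>e\<in>M. \<forall>G\<in>\<F>. leaves_in G \<noteq> e"
    using M unfolding plain_pairing_def by simp_all
  have disj: "{A, B} \<inter> e = {}" if "e \<in> M" for e using new that by blast
  have "pairing (insert {A, B} M)"
  proof (rule pairingI)
    fix e assume e: "e \<in> insert {A, B} M"
    show "\<exists>A B. e = {A, B} \<and> A \<noteq> B \<and> A \<in> leaves \<and> B \<in> leaves \<and> W A B > 0"
    proof (cases "e \<in> M")
      case True
      then show ?thesis by (rule pairing_elim[OF pM]) (intro exI conjI)
    next
      case False
      then show ?thesis using e AB unfolding plain_link_def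
        by (intro exI[of _ A] exI[of _ B]) simp
    qed
  next
    fix e e' assume "e \<in> insert {A, B} M" "e' \<in> insert {A, B} M" "e \<noteq> e'"
    then show "e \<inter> e' = {}"
      using disj[of e] disj[of e'] pairing_disjoint[OF pM, of e e'] by (metis inf_commute insertE)
  qed
  then show ?thesis
    using tM AB unfolding plain_pairing_def plain_link_def by simp
qed

lemma plain_pairing_subset: "plain_pairing M \<Longrightarrow> N \<subseteq> M \<Longrightarrow> plain_pairing N"
  unfolding plain_pairing_def pairing_def by (simp add: subset_iff)

lemma maximum_plain_pairing:
  "\<exists>M. plain_pairing M \<and> (\<forall>N. plain_pairing N \<longrightarrow> card N \<le> card M)"
proof -
  define S where "S = {M. plain_pairing M}"
  have "S \<subseteq> Pow (Pow leaves)"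
    unfolding S_def plain_pairing_def using pairing_leaves by blast
  then have "finite S" by (rule finite_subset) (simp add: finite_leaves)
  then have fin: "finite (card ` S)" by simp
  have "{} \<in> S" unfolding S_def plain_pairing_def pairing_def by simp
  then have "Max (card ` S) \<in> card ` S" using fin by (intro Max_in) auto
  then obtain M where M: "M \<in> S" "card M = Max (card ` S)" by auto
  have "card N \<le> card M" if "plain_pairing N" for N
    unfolding M(2) using fin that by (intro Max_ge) (auto simp: S_def)
  then show ?thesis using M(1) unfolding S_def by blast
qed

section \<open>Twins\<close>

definition twin_pairs :: "'a set set set" where
  "twin_pairs = {e. card e = 2 \<and> (\<exists>G\<in>\<F>. leaves_in G = e)}"

text \<open>Several nested members may have the same two leaves. One of them is fixed, so that
  different pairs get disjoint sets.\<close>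

definition twin_set :: "'a set set \<Rightarrow> 'a set" where
  "twin_set e = (SOME G. G \<in> \<F> \<and> leaves_in G = e)"

lemma twin_set:
  assumes "e \<in> twin_pairs"
  shows "twin_set e \<in> \<F>" "leaves_in (twin_set e) = e"
proof -
  have "\<exists>G. G \<in> \<F> \<and> leaves_in G = e" using assms unfolding twin_pairs_def by blast
  from someI_ex[OF this] show "twin_set e \<in> \<F>" "leaves_in (twin_set e) = e"
    unfolding twin_set_def by simp_all
qed

lemma twin_pairs_leaves: "e \<in> twin_pairs \<Longrightarrow> e \<subseteq> leaves"
  unfolding twin_pairs_def leaves_in_def by auto

lemma twin_set_disjoint:
  assumes e: "e \<in> twin_pairs" and e': "e' \<in> twin_pairs" and ne: "e \<noteq> e'"
  shows "twin_set e \<inter> twin_set e' = {}"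
proof (rule ccontr)
  assume "twin_set e \<inter> twin_set e' \<noteq> {}"
  then have "twin_set e \<subseteq> twin_set e' \<or> twin_set e' \<subseteq> twin_set e"
    using laminar[OF twin_set(1)[OF e] twin_set(1)[OF e']] by simp
  then have "e \<subseteq> e' \<or> e' \<subseteq> e"
    using leaves_in_mono twin_set(2)[OF e] twin_set(2)[OF e'] by metis
  moreover have "card e = 2" "card e' = 2" using e e' unfolding twin_pairs_def by simp_all
  moreover from this have "finite e" "finite e'" using card.infinite by fastforce+
  ultimately have "e = e'" by (metis card_subset_eq)
  then show False using ne by simp
qed

lemma twin_pairs_disjoint:
  assumes e: "e \<in> twin_pairs" and e': "e' \<in> twin_pairs" and A: "A \<in> e" "A \<in> e'"
  shows "e = e'"
proof (rule ccontr)
  assume "e \<noteq> e'"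
  then have "twin_set e \<inter> twin_set e' = {}" by (rule twin_set_disjoint[OF e e'])
  moreover have "A \<in> leaves" "A \<subseteq> twin_set e" "A \<subseteq> twin_set e'"
    using A twin_set(2)[OF e] twin_set(2)[OF e'] unfolding leaves_in_def by blast+
  ultimately show False using leaf_nonempty by blast
qed

text \<open>Two leaves of degree 1 with weight \<open>W A B\<close> between them send at most
  \<open>2 - 2 * W A B\<close> out of the set. The cut of the set needs 1, and the vertices outside
  the leaves must supply the difference.\<close>

lemma twin_credit:
  assumes e: "e \<in> twin_pairs" and AB: "e = {A, B}" "A \<noteq> B"
  shows "2 * W A B - 1 \<le> W (rest \<inter> twin_set e) V"
proof -
  define G where "G = twin_set e"
  have G: "G \<in> \<F>" "leaves_in G = {A, B}" using twin_set[OF e] AB unfolding G_def by simp_all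
  have leaf: "A \<in> leaves" "B \<in> leaves" using twin_pairs_leaves[OF e] AB by auto
  have A: "W A V = W A A + W A B + W A (rest \<inter> G) + W A (V - G)"
    using W_V[OF G(1), of A] W_split[of G A] G AB(2) by simp
  have B: "W B V = W B A + W B B + W B (rest \<inter> G) + W B (V - G)"
    using W_V[OF G(1), of B] W_split[of G B] G AB(2) by simp
  have "W G (V - G) = W (rest \<inter> G) (V - G) + W A (V - G) + W B (V - G)"
    using W_split_left[of G "V - G"] G AB(2) by simp
  moreover have "W (rest \<inter> G) (V - G) \<le> W (rest \<inter> G) V" by (rule W_mono) auto
  moreover have "W A V = 1" "W B V = 1" using leaf_unit leaf by simp_all
  ultimately show ?thesis
    using cut_ge_1[OF G(1)] A B W_nonneg[of A "rest \<inter> G"] W_nonneg[of B "rest \<inter> G"]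
      W_nonneg[of A A] W_nonneg[of B B] W_sym[of A B]
    unfolding G_def[symmetric] by linarith
qed

lemma leaves_in_V: "leaves_in V = leaves"
  using leaf_subset_V unfolding leaves_in_def by auto

lemma rest_V: "rest \<inter> V = rest"
  unfolding rest_def by blast

section \<open>Unmatched leaves and the bound 14/15\<close>

definition plain_weight :: "'a set \<Rightarrow> 'a set \<Rightarrow> real" where
  "plain_weight A B = (if plain_link A B then W A B else 0)"

lemma plain_weight_le: "0 \<le> plain_weight A B" "plain_weight A B \<le> W A B"
  unfolding plain_weight_def by simp_all

lemma sum_W_leaves_le:
  assumes "S \<subseteq> leaves" "B \<in> leaves"
  shows "(\<Sum>A\<in>S. W A B) \<le> 1"
proof -
  have "(\<Sum>A\<in>S. W A B) \<le> (\<Sum>A\<in>leaves. W A B)"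
    by (rule sum_mono2[OF finite_leaves assms(1)]) simp
  also have "\<dots> \<le> W V B"
    using W_split_left[of V B] leaves_in_V W_nonneg[of "rest \<inter> V" B] by simp
  also have "\<dots> = 1" using leaf_unit[OF assms(2)] W_sym by metis
  finally show ?thesis .
qed

text \<open>Every pair of \<open>M\<close> receives at most 1 from the unmatched leaves. If only one
  of its leaves has unmatched plain neighbours, the degree of that leaf is the bound. If both have
  some, they share a single one, whose degree is the bound: two different ones would be the ends of
  an augmenting path of length 3.\<close>

lemma maximum_pairing_exposed_weight:
  assumes M: "plain_pairing M" and max: "\<And>N. plain_pairing N \<Longrightarrow> card N \<le> card M"
  defines "U \<equiv> leaves - \<Union>M"
  shows "(\<Sum>A\<in>U. \<Sum>B\<in>leaves. plain_weight A B) \<le> card M"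
proof -
  have pM: "pairing M" using M unfolding plain_pairing_def by simp
  have finM: "finite M" by (rule finite_pairing[OF pM])
  have finU: "finite U" and UL: "U \<subseteq> leaves" unfolding U_def using finite_leaves by auto
  have UU: "\<not> plain_link A B" if "A \<in> U" "B \<in> U" for A B
  proof
    assume "plain_link A B"
    then have "plain_pairing (insert {A, B} M)"
      using plain_pairing_insert[OF M] that unfolding U_def by blast
    then have "card (insert {A, B} M) \<le> card M" by (rule max)
    moreover have "{A, B} \<notin> M" using that unfolding U_def by blast
    ultimately show False using finM by simp
  qed
  have aug: "A = A'" if e: "{B, C} \<in> M" "B \<noteq> C" and A: "A \<in> U" "plain_link A B"
    and A': "A' \<in> U" "plain_link A' C" for A A' B C
  proof (rule ccontr)
    assume ne: "A \<noteq> A'"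
    define M1 where "M1 = M - {{B, C}}"
    have out: "X \<notin> \<Union>M1" if "X \<in> {B, C}" for X
      using pairing_disjoint[OF pM _ e(1)] that unfolding M1_def by blast
    have outU: "X \<notin> \<Union>M1" "X \<notin> {B, C}" if "X \<in> U" for X
      using that e(1) unfolding M1_def U_def by blast+
    have "plain_pairing M1" by (rule plain_pairing_subset[OF M]) (auto simp: M1_def)
    then have 1: "plain_pairing (insert {A, B} M1)"
      using plain_pairing_insert[OF _ A(2)] outU[OF A(1)] out[of B] by simp
    have "A' \<notin> \<Union>(insert {A, B} M1)" "C \<notin> \<Union>(insert {A, B} M1)"
      using outU[OF A'(1)] outU[OF A(1)] out[of C] ne e(2) by auto
    then have "plain_pairing (insert {A', C} (insert {A, B} M1))"
      using plain_pairing_insert[OF 1 A'(2)] by simp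
    then have "card (insert {A', C} (insert {A, B} M1)) \<le> card M" by (rule max)
    moreover have "{A', C} \<notin> insert {A, B} M1"
      using \<open>A' \<notin> \<Union>(insert {A, B} M1)\<close> by blast
    moreover have "{A, B} \<notin> M1" using outU[OF A(1)] by blast
    moreover have "finite M1" "card M = Suc (card M1)"
      using finM e(1) unfolding M1_def by (simp, metis card.remove)
    ultimately show False by simp
  qed
  have pair_bound: "(\<Sum>B\<in>e. \<Sum>A\<in>U. plain_weight A B) \<le> 1" if e: "e \<in> M" for e
  proof -
    obtain B C where BC: "e = {B, C}" "B \<noteq> C" "B \<in> leaves" "C \<in> leaves"
      using pairing_elim[OF pM e] .
    have le: "(\<Sum>A\<in>U. plain_weight A X) \<le> 1" if "X \<in> leaves" for X
      using sum_mono[of U "\<lambda>A. plain_weight A X" "\<lambda>A. W A X"] plain_weight_le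
        sum_W_leaves_le[OF UL that] by fastforce
    have single: "(\<Sum>A\<in>U. plain_weight A X) = plain_weight A0 X"
      if "A0 \<in> U" "\<And>A. A \<in> U \<Longrightarrow> plain_link A X \<Longrightarrow> A = A0" for A0 X
    proof (rule sum_eq_single[OF finU that(1)])
      show "plain_weight A X = 0" if "A \<in> U" "A \<noteq> A0" for A
        using \<open>\<And>A. A \<in> U \<Longrightarrow> plain_link A X \<Longrightarrow> A = A0\<close>[OF that(1)] that(2)
        unfolding plain_weight_def by auto
    qed
    have none: "(\<Sum>A\<in>U. plain_weight A X) = 0" if "\<not> (\<exists>A\<in>U. plain_link A X)" for X
      using that unfolding plain_weight_def by (intro sum.neutral) auto
    have "(\<Sum>A\<in>U. plain_weight A B) + (\<Sum>A\<in>U. plain_weight A C) \<le> 1"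
    proof (cases "(\<exists>A\<in>U. plain_link A B) \<and> (\<exists>A\<in>U. plain_link A C)")
      case True
      then obtain A0 A1 where A0: "A0 \<in> U" "plain_link A0 B" and A1: "A1 \<in> U" "plain_link A1 C"
        by blast
      note aug' = aug[OF e[unfolded BC(1)] BC(2)]
      have "A0 = A1" by (rule aug'[OF A0 A1])
      have "(\<Sum>A\<in>U. plain_weight A B) = plain_weight A0 B"
        by (rule single[OF A0(1)]) (use aug'[OF _ _ A1] \<open>A0 = A1\<close> in blast)
      moreover have "(\<Sum>A\<in>U. plain_weight A C) = plain_weight A0 C"
        by (rule single[OF A0(1)]) (use aug'[OF A0] in blast)
      moreover have "W A0 B + W A0 C \<le> 1"
      proof -
        have "(\<Sum>X\<in>{B, C}. W X A0) \<le> 1"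
          by (rule sum_W_leaves_le) (use A0(1) UL BC in auto)
        then show ?thesis using BC(2) by (simp add: W_sym[of A0])
      qed
      ultimately show ?thesis using plain_weight_le(2)[of A0 B] plain_weight_le(2)[of A0 C] by linarith
    next
      case False
      then show ?thesis using none[of B] none[of C] le[OF BC(3)] le[OF BC(4)] by fastforce
    qed
    then show ?thesis unfolding BC(1) using BC(2) by simp
  qed
  \<comment> \<open>By maximality no plain link joins two unmatched leaves, so only matched leaves
    contribute.\<close>
  have "(\<Sum>B\<in>leaves. plain_weight A B) = (\<Sum>B\<in>\<Union>M. plain_weight A B)" if A: "A \<in> U" for A
  proof (rule sum.mono_neutral_right[OF finite_leaves])
    show "\<Union>M \<subseteq> leaves" using pairing_leaves[OF pM] by blast
    show "\<forall>B\<in>leaves - \<Union>M. plain_weight A B = 0"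
      using UU[OF A] unfolding U_def plain_weight_def by auto
  qed
  then have "(\<Sum>A\<in>U. \<Sum>B\<in>leaves. plain_weight A B) = (\<Sum>A\<in>U. \<Sum>B\<in>\<Union>M. plain_weight A B)"
    by (rule sum.cong[OF refl])
  also have "\<dots> = (\<Sum>B\<in>\<Union>M. \<Sum>A\<in>U. plain_weight A B)" by (rule sum.swap)
  also have "\<dots> = (\<Sum>e\<in>M. \<Sum>B\<in>e. \<Sum>A\<in>U. plain_weight A B)"
  proof (rule sum.Union_disjoint[unfolded o_def])
    show "\<forall>e\<in>M. finite e" using pairing_leaves[OF pM] finite_leaves finite_subset by blast
    show "\<forall>e\<in>M. \<forall>e'\<in>M. e \<noteq> e' \<longrightarrow> e \<inter> e' = {}" using pairing_disjoint[OF pM] by simp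
  qed
  also have "\<dots> \<le> (\<Sum>e\<in>M. 1)" by (rule sum_mono) (rule pair_bound)
  finally show ?thesis by simp
qed

text \<open>The weight on the left goes to a twin of \<open>A\<close>. There is at most one twin,
  because the sets of different twin pairs are disjoint, and \<open>twin_credit\<close> applies to
  it. Without weight to a twin the left side is -1.\<close>

lemma twin_weight:
  assumes A: "A \<in> leaves"
  shows "2 * (\<Sum>B\<in>leaves. W A B - plain_weight A B) - 1
    \<le> (\<Sum>e\<in>twin_pairs. if A \<in> e then W (rest \<inter> twin_set e) V else 0)"
    (is "2 * ?t - 1 \<le> ?k")
proof -
  have fin: "finite twin_pairs"
    by (rule finite_subset[of _ "Pow leaves"]) (use twin_pairs_leaves finite_leaves in auto)
  have k_nonneg: "0 \<le> ?k" by (rule sum_nonneg) simp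
  have twin: "{A, B} \<in> twin_pairs" "A \<noteq> B" if B: "B \<in> leaves" and pos: "W A B - plain_weight A B \<noteq> 0" for B
  proof -
    show "A \<noteq> B" using pos leaf_inner[OF A] plain_weight_le[of A A] by auto
    moreover have "W A B > 0"
      using pos plain_weight_le[of A B] W_nonneg[of A B] by linarith
    moreover have "\<not> plain_link A B" using pos unfolding plain_weight_def by auto
    ultimately show "{A, B} \<in> twin_pairs"
      using A B unfolding plain_link_def twin_pairs_def by auto
  qed
  show ?thesis
  proof (cases "\<exists>B\<in>leaves. W A B - plain_weight A B \<noteq> 0")
    case False
    then have "?t = 0" by (intro sum.neutral) blast
    then show ?thesis using k_nonneg by simp
  next
    case True
    then obtain B where B: "B \<in> leaves" "W A B - plain_weight A B \<noteq> 0" by blast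
    have uniq: "C = B" if C: "C \<in> leaves" "W A C - plain_weight A C \<noteq> 0" for C
    proof -
      have "{A, C} = {A, B}"
        using twin_pairs_disjoint[OF twin(1)[OF C] twin(1)[OF B], of A] by simp
      then show ?thesis using twin(2)[OF C] by (metis doubleton_eq_iff)
    qed
    have "?t = W A B - plain_weight A B"
      by (rule sum_eq_single[OF finite_leaves B(1)]) (use uniq in blast)
    then have "?t \<le> W A B" using plain_weight_le(1)[of A B] by linarith
    moreover have "2 * W A B - 1 \<le> W (rest \<inter> twin_set {A, B}) V"
      by (rule twin_credit[OF twin(1)[OF B] refl twin(2)[OF B]])
    moreover have "(if A \<in> {A, B} then W (rest \<inter> twin_set {A, B}) V else 0) \<le> ?k"
      by (rule member_le_sum[OF twin(1)[OF B]]) (use fin in auto)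
    ultimately show ?thesis by simp
  qed
qed

text \<open>Each twin pair is charged from its two leaves, and the sets \<open>twin_set e\<close>
  are disjoint.\<close>

lemma sum_twin_credit:
  "(\<Sum>A\<in>leaves. \<Sum>e\<in>twin_pairs. if A \<in> e then W (rest \<inter> twin_set e) V else 0) \<le> 2 * W rest V"
proof -
  have fin: "finite twin_pairs"
    by (rule finite_subset[of _ "Pow leaves"]) (use twin_pairs_leaves finite_leaves in auto)
  have "(\<Sum>A\<in>leaves. if A \<in> e then c else 0) = 2 * c" if e: "e \<in> twin_pairs" for e and c :: real
  proof -
    have "leaves \<inter> e = e" using twin_pairs_leaves[OF e] by blast
    moreover have "card e = 2" using e unfolding twin_pairs_def by simp
    ultimately show ?thesis
      by (simp add: sum.If_cases[OF finite_leaves])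
  qed
  then have "(\<Sum>A\<in>leaves. \<Sum>e\<in>twin_pairs. if A \<in> e then W (rest \<inter> twin_set e) V else 0)
      = (\<Sum>e\<in>twin_pairs. 2 * W (rest \<inter> twin_set e) V)"
    by (subst sum.swap) (rule sum.cong[OF refl])
  also have "\<dots> = 2 * (\<Sum>e\<in>twin_pairs. W V (rest \<inter> twin_set e))"
    by (simp add: sum_distrib_left W_sym[of V])
  also have "(\<Sum>e\<in>twin_pairs. W V (rest \<inter> twin_set e)) = W V (\<Union>e\<in>twin_pairs. rest \<inter> twin_set e)"
    unfolding W_def
  proof (subst sum.UNION_disjoint)
    show "\<forall>e\<in>twin_pairs. finite (rest \<inter> twin_set e)"
      using finite_V unfolding rest_def by auto
    show "\<forall>e\<in>twin_pairs. \<forall>e'\<in>twin_pairs. e \<noteq> e' \<longrightarrow> (rest \<inter> twin_set e) \<inter> (rest \<inter> twin_set e') = {}"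
      using twin_set_disjoint by blast
  qed (use fin in \<open>auto simp: sum.swap[of _ V]\<close>)
  also have "\<dots> \<le> W V rest"
    by (rule W_mono) (auto simp: rest_def)
  also have "\<dots> = W rest V" by (rule W_sym)
  finally show ?thesis by simp
qed

lemma cover_bound:
  "\<exists>J \<subseteq> links. (\<forall>G\<in>\<F>. \<exists>j\<in>J. crosses G j) \<and> card J \<le> 14 / 15 * W V V"
proof -
  obtain M where M: "plain_pairing M" and max: "\<And>N. plain_pairing N \<Longrightarrow> card N \<le> card M"
    using maximum_plain_pairing by blast
  have pM: "pairing M" using M unfolding plain_pairing_def by simp
  have light: "W A (V - A) \<le> 1" if "A \<in> \<Union>M" for A
  proof -
    have "A \<in> leaves" using that pairing_leaves[OF pM] by blast
    then show ?thesis using W_leaf_cut[of A] leaf_unit[of A] leaf_inner[of A] by simp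
  qed
  have no_twin: "leaves_in G \<noteq> e" if "e \<in> M" "G \<in> \<F>" for e G
    using M that unfolding plain_pairing_def by simp
  obtain J where J: "J \<subseteq> links" "\<forall>G\<in>\<F>. \<exists>j\<in>J. crosses G j"
    "card J \<le> card leaves - card M / 3 + 2 / 3 * W rest V"
    using laminar_cover[OF laminar_cuts_axioms pM light no_twin] by blast
  define U where "U = leaves - \<Union>M"
  have UL: "U \<subseteq> leaves" unfolding U_def by blast
  have "card leaves = card U + 2 * card M"
  proof -
    have "\<Union>M \<subseteq> leaves" using pairing_leaves[OF pM] by blast
    then have "card leaves = card U + card (\<Union>M)"
      unfolding U_def using finite_leaves card_mono[OF finite_leaves, of "\<Union>M"]
      by (simp add: card_Diff_subset finite_subset)
    then show ?thesis using card_Union_pairing[OF pM order_refl] by simp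
  qed
  moreover have "card U \<le> 2 * card M + 4 * W rest V"
  proof -
    define h where "h A = (\<Sum>B\<in>leaves. plain_weight A B)" for A
    define t where "t A = (\<Sum>B\<in>leaves. W A B - plain_weight A B)" for A
    define k where "k A = (\<Sum>e\<in>twin_pairs. if A \<in> e then W (rest \<inter> twin_set e) V else 0)" for A
    \<comment> \<open>The unit degree of an unmatched leaf divides into weight to vertices outside
      the leaves, plain weight and twin weight. Only the excess of the twin weight over 1/2 is
      charged to the twin set, hence the factor 2 in the next inequality.\<close>
    have unit: "1 = W A rest + h A + t A" if "A \<in> U" for A
    proof -
      have "W A V = 1" using leaf_unit that UL by blast
      then show ?thesis
        using W_split[of V A] unfolding h_def t_def leaves_in_V rest_V by (simp add: sum_subtractf)
    qed
    have "1 \<le> 2 * h A + k A + 2 * W A rest" if "A \<in> U" for A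
    proof -
      have "2 * t A - 1 \<le> k A" unfolding t_def k_def by (rule twin_weight) (use that UL in blast)
      then show ?thesis using unit[OF that] by linarith
    qed
    then have "(\<Sum>A\<in>U. 1) \<le> (\<Sum>A\<in>U. 2 * h A + k A + 2 * W A rest)" by (rule sum_mono)
    also have "\<dots> = 2 * (\<Sum>A\<in>U. h A) + (\<Sum>A\<in>U. k A) + 2 * (\<Sum>A\<in>U. W A rest)"
      by (simp add: sum.distrib sum_distrib_left)
    also have "(\<Sum>A\<in>U. h A) \<le> card M"
      unfolding h_def U_def by (rule maximum_pairing_exposed_weight[OF M max])
    also have "(\<Sum>A\<in>U. k A) \<le> 2 * W rest V"
    proof -
      have "(\<Sum>A\<in>U. k A) \<le> (\<Sum>A\<in>leaves. k A)"
        by (rule sum_mono2[OF finite_leaves UL]) (auto simp: k_def intro!: sum_nonneg)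
      then show ?thesis using sum_twin_credit unfolding k_def by linarith
    qed
    also have "(\<Sum>A\<in>U. W A rest) \<le> W rest V"
    proof -
      have "(\<Sum>A\<in>U. W A rest) \<le> (\<Sum>A\<in>leaves. W A rest)"
        by (rule sum_mono2[OF finite_leaves UL]) simp
      also have "\<dots> \<le> W V rest"
        using W_split_left[of V rest] leaves_in_V W_nonneg[of "rest \<inter> V" rest] by simp
      finally show ?thesis by (simp add: W_sym[of V])
    qed
    finally show ?thesis by simp
  qed
  moreover have "W V V = W rest V + card leaves"
    using W_split_left[of V V] leaf_unit unfolding leaves_in_V rest_V by simp
  moreover have "0 \<le> W rest V" by simp
  \<comment> \<open>One fifteenth of \<open>card leaves \<le> 4 * card M + 4 * W rest V\<close>
    enters the bound on \<open>card J\<close>: it costs 4/15 per pair, less than the 1/3 saved, and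
    raises the coefficient of \<open>W rest V\<close> from 2/3 to 14/15.\<close>
  ultimately have "card J \<le> 14 / 15 * W V V" using J(3) by simp
  then show ?thesis using J(1,2) by blast
qed

end

section \<open>Reduction to unit leaf degrees\<close>

context laminar_cuts
begin

text \<open>
  Every vertex \<open>u\<close> is split into \<open>(u, True)\<close> and \<open>(u, False)\<close>. If \<open>u\<close> lies in a leaf \<open>A\<close>, then only
  the first copy stays in \<open>A\<close>, with a share of the links of \<open>u\<close> that scales the degree of \<open>A\<close> down
  to 1. The remaining weight sits just outside of \<open>A\<close>, so that all other cuts keep their value.
\<close>

definition share :: "'a \<Rightarrow> bool \<Rightarrow> real" where
  "share u i = (let s = \<Sum>A\<in>leaves. if u \<in> A then 1 / W A (V - A) else 0 in if i then s else 1 - s)"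

definition split_weight :: "'a \<times> bool \<Rightarrow> 'a \<times> bool \<Rightarrow> real" where
  "split_weight p q = w (fst p) (fst q) * share (fst p) (snd p) * share (fst q) (snd q)"

definition lift :: "'a set \<Rightarrow> ('a \<times> bool) set" where
  "lift D = (if D \<in> leaves then D \<times> {True} else D \<times> UNIV)"

lemma share_leaf:
  assumes "A \<in> leaves" "u \<in> A"
  shows "share u True = 1 / W A (V - A)"
proof -
  have "(\<Sum>B\<in>leaves. if u \<in> B then 1 / W B (V - B) else 0) = (if u \<in> A then 1 / W A (V - A) else 0)"
  proof (rule sum_eq_single[OF finite_leaves assms(1)])
    show "(if u \<in> B then 1 / W B (V - B) else 0) = 0" if "B \<in> leaves" "B \<noteq> A" for B
      using leaves_disjoint[OF that(1) assms(1) that(2)] assms(2) by auto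
  qed
  then show ?thesis unfolding share_def using assms(2) by simp
qed

lemma share_bounds: "0 \<le> share u i" "share u i \<le> 1"
proof -
  have "0 \<le> share u True \<and> share u True \<le> 1"
  proof (cases "\<exists>A\<in>leaves. u \<in> A")
    case True
    then obtain A where A: "A \<in> leaves" "u \<in> A" by blast
    then show ?thesis
      using share_leaf[OF A] cut_ge_1[OF leaf_F[OF A(1)]] by simp
  next
    case False
    then have "(\<Sum>B\<in>leaves. if u \<in> B then 1 / W B (V - B) else 0) = 0"
      by (intro sum.neutral) simp
    then show ?thesis unfolding share_def by simp
  qed
  then show "0 \<le> share u i" "share u i \<le> 1"
    unfolding share_def Let_def by (cases i; simp)+
qed

lemma share_sum: "(\<Sum>i\<in>UNIV. share u i) = 1"
  unfolding share_def Let_def UNIV_bool by simp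

sublocale split: weighted_links "V \<times> UNIV" split_weight
  by unfold_locales
    (use finite_V w_nonneg share_bounds in \<open>auto simp: split_weight_def w_sym mult_ac\<close>)

lemma split_W_times:
  "split.W (A \<times> I) (B \<times> K) =
    (\<Sum>u\<in>A. \<Sum>v\<in>B. w u v * (\<Sum>i\<in>I. share u i) * (\<Sum>k\<in>K. share v k))"
proof -
  have "split.W (A \<times> I) (B \<times> K) =
      (\<Sum>u\<in>A. \<Sum>i\<in>I. \<Sum>v\<in>B. \<Sum>k\<in>K. w u v * share u i * share v k)"
    unfolding split.W_def split_weight_def by (simp add: sum.cartesian_product')
  also have "\<dots> = (\<Sum>u\<in>A. \<Sum>v\<in>B. \<Sum>i\<in>I. \<Sum>k\<in>K. w u v * share u i * share v k)"
    by (rule sum.cong[OF refl]) (rule sum.swap)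
  also have "\<dots> = (\<Sum>u\<in>A. \<Sum>v\<in>B. w u v * (\<Sum>i\<in>I. share u i) * (\<Sum>k\<in>K. share v k))"
  proof (intro sum.cong[OF refl])
    fix u v
    show "(\<Sum>i\<in>I. \<Sum>k\<in>K. w u v * share u i * share v k)
        = w u v * (\<Sum>i\<in>I. share u i) * (\<Sum>k\<in>K. share v k)"
      unfolding mult.assoc sum_product by (simp add: sum_distrib_left)
  qed
  finally show ?thesis .
qed

lemma split_W_full: "split.W (A \<times> UNIV) (B \<times> UNIV) = W A B"
  unfolding split_W_times share_sum W_def by simp

lemma split_W_leaf: "A \<in> leaves \<Longrightarrow> split.W (A \<times> {True}) (B \<times> UNIV) = W A B / W A (V - A)"
  unfolding split_W_times share_sum W_def[of A B] sum_divide_distrib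
  by (intro sum.cong[OF refl]) (simp add: share_leaf)

lemma lift_subset_iff: "D \<in> \<F> \<Longrightarrow> G \<in> \<F> \<Longrightarrow> lift D \<subset> lift G \<longleftrightarrow> D \<subset> G"
proof
  assume D: "D \<in> \<F>" and G: "G \<in> \<F>"
  show "D \<subset> G \<Longrightarrow> lift D \<subset> lift G"
    using D unfolding lift_def leaves_def by auto
  assume sub: "lift D \<subset> lift G"
  then have "fst ` lift D \<subseteq> fst ` lift G" by blast
  then have "D \<subseteq> G" unfolding lift_def by (simp split: if_splits)
  then show "D \<subset> G" using sub by blast
qed

text \<open>No member separates two vertices of a leaf, so leaves have no inner weight by
  \<open>unseparated\<close>. The degree of a leaf is thus its cut weight, and scaling by its
  inverse gives 1. Other members keep both copies of their vertices and therefore the value of their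
  cut.\<close>

lemma unit_leaf_cuts_lift:
  assumes unseparated: "\<And>u v. (\<And>D. D \<in> \<F> \<Longrightarrow> u \<in> D \<longleftrightarrow> v \<in> D) \<Longrightarrow> w u v = 0"
  shows "unit_leaf_cuts (V \<times> UNIV) split_weight (lift ` \<F>)"
proof -
  have inner: "W A A = 0" if A: "A \<in> leaves" for A
    unfolding W_def using unseparated leaf_cases[OF A] by (intro sum.neutral ballI) blast
  have leaf_V: "split.W (A \<times> {True}) (V \<times> UNIV) = 1" if A: "A \<in> leaves" for A
    using split_W_leaf[OF A, of V] W_V[OF leaf_F[OF A], of A] inner[OF A] cut_ge_1[OF leaf_F[OF A]]
    by simp
  have leaf_inner: "split.W (A \<times> {True}) (A \<times> {True}) = 0" if A: "A \<in> leaves" for A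
  proof -
    have "split.W (A \<times> {True}) (A \<times> {True}) \<le> split.W (A \<times> {True}) (A \<times> UNIV)"
      using leaf_subset_V[OF A] by (intro split.W_mono) auto
    also have "\<dots> = 0" using split_W_leaf[OF A] inner[OF A] by simp
    finally show ?thesis using split.W_nonneg[of "A \<times> {True}" "A \<times> {True}"] by linarith
  qed
  interpret S: laminar_cuts "V \<times> UNIV" split_weight "lift ` \<F>"
  proof unfold_locales
    fix X assume "X \<in> lift ` \<F>"
    then obtain D where D: "D \<in> \<F>" "X = lift D" by blast
    show "X \<subseteq> V \<times> UNIV" using subset_V[OF D(1)] D(2) unfolding lift_def by auto
    show "1 \<le> split.W X (V \<times> UNIV - X)"
    proof (cases "D \<in> leaves")
      case True
      have "A \<times> {True} \<subseteq> V \<times> UNIV" if "A \<in> leaves" for A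
        using leaf_subset_V[OF that] by blast
      then show ?thesis
        using split.W_diff[of "D \<times> {True}" "V \<times> UNIV"] leaf_V[OF True] leaf_inner[OF True] D(2) True
        unfolding lift_def by simp
    next
      case False
      then have "X = D \<times> UNIV" "V \<times> UNIV - X = (V - D) \<times> UNIV" using D(2) unfolding lift_def by auto
      then show ?thesis using split_W_full[of D "V - D"] cut_ge_1[OF D(1)] by simp
    qed
  next
    fix X Y assume "X \<in> lift ` \<F>" "Y \<in> lift ` \<F>"
    then obtain D G where D: "D \<in> \<F>" "X = lift D" and G: "G \<in> \<F>" "Y = lift G" by blast
    have "D = G \<or> D \<subset> G \<or> G \<subset> D \<or> D \<inter> G = {}" using laminar[OF D(1) G(1)] by blast
    then show "X \<subseteq> Y \<or> Y \<subseteq> X \<or> X \<inter> Y = {}"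
    proof (elim disjE)
      assume "D \<inter> G = {}"
      then have "X \<inter> Y = {}" using D(2) G(2) unfolding lift_def by auto
      then show ?thesis by simp
    qed (use lift_subset_iff D G in blast)+
  qed
  have leaves': "S.leaves = (\<lambda>A. A \<times> {True}) ` leaves"
  proof -
    have "lift D \<in> S.leaves \<longleftrightarrow> D \<in> leaves" if "D \<in> \<F>" for D
      unfolding S.leaves_def leaves_def using lift_subset_iff[OF _ that] that by simp
    moreover have "S.leaves \<subseteq> lift ` \<F>" "leaves \<subseteq> \<F>"
      unfolding S.leaves_def leaves_def by simp_all
    ultimately have "S.leaves = lift ` leaves" by (intro equalityI subsetI) auto
    also have "\<dots> = (\<lambda>A. A \<times> {True}) ` leaves"
      by (rule image_cong) (simp_all add: lift_def)
    finally show ?thesis .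
  qed
  show ?thesis
    by unfold_locales (use leaves' leaf_V leaf_inner in auto)
qed

text \<open>A cover of the split family is projected to the original vertices. The total weight is
  the same, since the two shares of a vertex add up to 1.\<close>

lemma laminar_gap:
  assumes unseparated: "\<And>u v. (\<And>D. D \<in> \<F> \<Longrightarrow> u \<in> D \<longleftrightarrow> v \<in> D) \<Longrightarrow> w u v = 0"
  shows "\<exists>J \<subseteq> links. (\<forall>D\<in>\<F>. \<exists>j\<in>J. crosses D j) \<and> card J \<le> 14 / 15 * W V V"
proof -
  interpret S: unit_leaf_cuts "V \<times> UNIV" split_weight "lift ` \<F>"
    by (rule unit_leaf_cuts_lift) (rule unseparated, blast)
  obtain J where J: "J \<subseteq> split.links" "\<forall>D\<in>\<F>. \<exists>j\<in>J. crosses (lift D) j"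
    "card J \<le> 14 / 15 * split.W (V \<times> UNIV) (V \<times> UNIV)"
    using S.cover_bound by auto
  define f where "f j = (fst (fst j), fst (snd j))" for j :: "('a \<times> bool) \<times> ('a \<times> bool)"
  have pos: "fst (f j) \<in> V" "snd (f j) \<in> V" "w (fst (f j)) (snd (f j)) > 0" if "j \<in> J" for j
  proof -
    have "j \<in> split.links" using J(1) that by blast
    then have "fst j \<in> V \<times> UNIV" "snd j \<in> V \<times> UNIV" "split_weight (fst j) (snd j) > 0"
      unfolding split.links_def by auto
    then show "fst (f j) \<in> V" "snd (f j) \<in> V" "w (fst (f j)) (snd (f j)) > 0"
      using w_nonneg[of "fst (fst j)" "fst (snd j)"] unfolding f_def split_weight_def
      by (auto simp: less_le)
  qed
  have "f j \<in> links" if "j \<in> J" for j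
    unfolding links_def using pos[OF that] by (simp add: case_prod_beta)
  then have "f ` J \<subseteq> links" by blast
  moreover have "\<exists>j\<in>f ` J. crosses D j" if D: "D \<in> \<F>" for D
  proof -
    obtain j where j: "j \<in> J" "crosses (lift D) j" using J(2) D by blast
    have "crosses D (f j)"
    proof (cases "D \<in> leaves")
      case True
      \<comment> \<open>A link crossing \<open>D \<times> {True}\<close> might end in
        \<open>D \<times> {False}\<close>. Its projection would then lie inside the leaf
        \<open>D\<close>, where all weights vanish.\<close>
      have "\<not> (fst (f j) \<in> D \<and> snd (f j) \<in> D)"
        using unseparated[of "fst (f j)" "snd (f j)"] leaf_cases[OF True] pos(3)[OF j(1)] by fastforce
      then show ?thesis
        using j(2) True unfolding crosses_def lift_def f_def by (auto simp: mem_Times_iff)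
    next
      case False
      then show ?thesis
        using j(2) unfolding crosses_def lift_def f_def by (auto simp: mem_Times_iff)
    qed
    then show ?thesis using j(1) by blast
  qed
  moreover have "card (f ` J) \<le> card J"
    by (rule card_image_le) (rule finite_subset[OF J(1) split.finite_links])
  then have "card (f ` J) \<le> 14 / 15 * W V V"
    using J(3) unfolding split_W_full by simp
  ultimately show ?thesis by (intro exI[of _ "f ` J"]) blast
qed

end

section \<open>Walks, connectivity and cuts of trees\<close>

lemma walk_nonempty: "is_walk G vs es \<Longrightarrow> vs \<noteq> []"
  by (cases "(G, vs, es)" rule: is_walk.cases) auto

lemma walk_snoc:
  assumes "is_walk G vs es" "e \<in> medges G" "mends G e = {last vs, v}" "v \<in> mverts G"
  shows "is_walk G (vs @ [v]) (es @ [e])"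
  using assms by (induction G vs es rule: is_walk.induct) auto

lemma walk_invariant:
  assumes "is_walk G vs es"
    and "\<And>e u v. e \<in> set es \<Longrightarrow> e \<in> medges G \<Longrightarrow> mends G e = {u, v} \<Longrightarrow> u \<in> X \<longleftrightarrow> v \<in> X"
  shows "hd vs \<in> X \<longleftrightarrow> last vs \<in> X"
  using assms by (induction G vs es rule: is_walk.induct) fastforce+

lemma walk_ends: "is_walk G vs es \<Longrightarrow> e \<in> set es \<Longrightarrow> e \<in> medges G \<and> mends G e \<subseteq> set vs"
  by (induction G vs es rule: is_walk.induct) auto

lemma walk_verts: "is_walk G vs es \<Longrightarrow> set vs \<subseteq> mverts G"
  by (induction G vs es rule: is_walk.induct) auto

lemma walk_distinct_edges: "is_walk G vs es \<Longrightarrow> distinct vs \<Longrightarrow> distinct es"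
proof (induction G vs es rule: is_walk.induct)
  case (2 G v w vs e es)
  then have "mends G e = {v, w}" "is_walk G (w # vs) es" by simp_all
  then have "e \<notin> set es" using walk_ends[of G "w # vs" es e] 2(3) by auto
  then show ?case using 2 by simp
qed simp_all

lemma walk_suffix: "is_walk G (xs @ v # ys) es \<Longrightarrow> \<exists>es'. is_walk G (v # ys) es' \<and> set es' \<subseteq> set es"
proof (induction xs arbitrary: es)
  case (Cons x xs)
  obtain z zs where z: "xs @ v # ys = z # zs" by (cases xs) auto
  then obtain e es' where "es = e # es'" "is_walk G (xs @ v # ys) es'"
    using Cons.prems by (cases es) auto
  then show ?case using Cons.IH[of es'] by auto
qed auto

lemma walk_to_path:
  "is_walk G vs es \<Longrightarrow> \<exists>vs' es'. is_path G (hd vs) vs' es' (last vs) \<and> set es' \<subseteq> set es"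
proof (induction G vs es rule: is_walk.induct)
  case (1 G v)
  then show ?case by (intro exI[of _ "[v]"] exI[of _ "[]"]) (simp add: is_path_def)
next
  case (2 G v w vs e es)
  then obtain vs' es' where p: "is_walk G vs' es'" "hd vs' = w" "last vs' = last (w # vs)"
      "distinct vs'" "set es' \<subseteq> set es"
    unfolding is_path_def by auto
  show ?case
  proof (cases "v \<in> set vs'")
    case True
    then obtain xs ys where xy: "vs' = xs @ v # ys" by (meson split_list)
    then obtain es'' where "is_walk G (v # ys) es''" "set es'' \<subseteq> set es'"
      using walk_suffix[of G xs v ys es'] p(1) by auto
    then show ?thesis
      using p xy by (intro exI[of _ "v # ys"] exI[of _ es'']) (auto simp: is_path_def)
  next
    case False
    obtain zs where zs: "vs' = w # zs"
      using walk_nonempty[OF p(1)] p(2) by (cases vs') auto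
    then have "is_walk G (v # vs') (e # es')" using 2(2) p(1) by simp
    then show ?thesis
      using p False zs by (intro exI[of _ "v # vs'"] exI[of _ "e # es'"]) (auto simp: is_path_def)
  qed
qed simp_all

section \<open>Connectivity in terms of invariant vertex sets\<close>

text \<open>Among sets of vertices of the graph these are the unions of connected
  components.\<close>

definition edge_invariant :: "('v, 'e) multigraph \<Rightarrow> 'v set \<Rightarrow> bool" where
  "edge_invariant G X \<longleftrightarrow> (\<forall>e\<in>medges G. \<forall>u\<in>mverts G. \<forall>v\<in>mverts G. mends G e = {u, v} \<longrightarrow> (u \<in> X \<longleftrightarrow> v \<in> X))"

definition reachable :: "('v, 'e) multigraph \<Rightarrow> 'v \<Rightarrow> 'v set" where
  "reachable G u = {v. \<exists>vs es. is_walk G vs es \<and> hd vs = u \<and> last vs = v}"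

lemma reachableI: "is_walk G vs es \<Longrightarrow> last vs \<in> reachable G (hd vs)"
  unfolding reachable_def by blast

lemma reachable_subset: "reachable G u \<subseteq> mverts G"
  unfolding reachable_def using walk_verts walk_nonempty by fastforce

lemma reachable_refl: "u \<in> mverts G \<Longrightarrow> u \<in> reachable G u"
  using reachableI[of G "[u]" "[]"] by simp

lemma reachable_invariant: "edge_invariant G (reachable G u)"
proof -
  have step: "v' \<in> reachable G u"
    if e: "e \<in> medges G" "mends G e = {v, v'}" and v: "v' \<in> mverts G" "v \<in> reachable G u" for e v v'
  proof -
    obtain vs es where w: "is_walk G vs es" "hd vs = u" "last vs = v"
      using v(2) unfolding reachable_def by auto
    have "is_walk G (vs @ [v']) (es @ [e])" by (rule walk_snoc) (use w e v in auto)
    from reachableI[OF this] show ?thesis using w(2) walk_nonempty[OF w(1)] by simp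
  qed
  show ?thesis
    unfolding edge_invariant_def
    by (intro ballI impI iffI) (auto intro: step simp: insert_commute)
qed

lemma reachable_least:
  assumes "edge_invariant G X" "u \<in> X"
  shows "reachable G u \<subseteq> X"
proof
  fix v assume "v \<in> reachable G u"
  then obtain vs es where w: "is_walk G vs es" "hd vs = u" "last vs = v"
    unfolding reachable_def by auto
  have "hd vs \<in> X \<longleftrightarrow> last vs \<in> X"
  proof (rule walk_invariant[OF w(1)])
    fix e a b assume e: "e \<in> set es" "e \<in> medges G" "mends G e = {a, b}"
    then have "a \<in> mverts G" "b \<in> mverts G"
      using walk_ends[OF w(1) e(1)] walk_verts[OF w(1)] by auto
    then show "a \<in> X \<longleftrightarrow> b \<in> X" using assms(1) e unfolding edge_invariant_def by blast
  qed
  then show "v \<in> X" using w assms(2) by simp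
qed

lemma graph_connected_iff:
  "graph_connected G \<longleftrightarrow> mverts G \<noteq> {} \<and>
     (\<forall>X\<subseteq>mverts G. edge_invariant G X \<longrightarrow> X = {} \<or> X = mverts G)"
proof
  assume G: "graph_connected G"
  have "X = {} \<or> X = mverts G" if X: "X \<subseteq> mverts G" "edge_invariant G X" for X
  proof (cases "X = {}")
    case False
    then obtain u where u: "u \<in> X" by blast
    then have "mverts G \<subseteq> reachable G u"
      using G X(1) unfolding graph_connected_def reachable_def by blast
    then show ?thesis using reachable_least[OF X(2) u] X(1) by blast
  qed simp
  then show "mverts G \<noteq> {} \<and> (\<forall>X\<subseteq>mverts G. edge_invariant G X \<longrightarrow> X = {} \<or> X = mverts G)"
    using G unfolding graph_connected_def by blast
next
  assume *: "mverts G \<noteq> {} \<and> (\<forall>X\<subseteq>mverts G. edge_invariant G X \<longrightarrow> X = {} \<or> X = mverts G)"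
  have "v \<in> reachable G u" if "u \<in> mverts G" "v \<in> mverts G" for u v
    using * reachable_subset[of G u] reachable_invariant[of G u] reachable_refl[OF that(1)] that(2) by blast
  then show "graph_connected G"
    using * unfolding graph_connected_def reachable_def by simp
qed

section \<open>Fundamental cuts of a rooted tree\<close>

text \<open>\<open>side f\<close> is the component of the tree without \<open>f\<close> that avoids the root \<open>r\<close>.\<close>

locale tree_sides =
  fixes V :: "'v set" and F :: "'v set set" and r :: 'v and side :: "'v set \<Rightarrow> 'v set"
  assumes finite_verts: "finite V"
    and edge_ends: "f \<in> F \<Longrightarrow> \<exists>a\<in>V. \<exists>b\<in>V. f = {a, b}"
    and connected: "graph_connected (base_graph V F)"
    and root: "r \<in> V"
    and side_verts: "f \<in> F \<Longrightarrow> side f \<subseteq> V"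
    and root_notin: "f \<in> F \<Longrightarrow> r \<notin> side f"
    and side_other: "f \<in> F \<Longrightarrow> {a, b} \<in> F \<Longrightarrow> {a, b} \<noteq> f \<Longrightarrow> a \<in> side f \<longleftrightarrow> b \<in> side f"
    and side_self: "{a, b} \<in> F \<Longrightarrow> a \<in> side {a, b} \<longleftrightarrow> b \<notin> side {a, b}"

lemma edge_invariant_base_graph:
  assumes "F \<subseteq> {{a, b} |a b. a \<in> V \<and> b \<in> V}"
  shows "edge_invariant (base_graph V F) X \<longleftrightarrow> (\<forall>a b. {a, b} \<in> F \<longrightarrow> (a \<in> X \<longleftrightarrow> b \<in> X))"
proof -
  have ends: "a \<in> V \<and> b \<in> V" if "{a, b} \<in> F" for a b
    using assms that by (fastforce simp: doubleton_eq_iff)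
  have "edge_invariant (base_graph V F) X \<longleftrightarrow>
      (\<forall>e\<in>F. \<forall>u\<in>V. \<forall>v\<in>V. e = {u, v} \<longrightarrow> (u \<in> X \<longleftrightarrow> v \<in> X))"
    unfolding edge_invariant_def base_graph_def by simp
  then show ?thesis using ends by blast
qed

text \<open>A path from \<open>b\<close> to \<open>a\<close> that avoids the edge closes up with it
  to a cycle; for \<open>a = b\<close> this is a loop.\<close>

lemma tree_bridge:
  assumes tree: "is_tree (base_graph V F)" and f: "{a, b} \<in> F" and ab: "a \<in> V" "b \<in> V"
  shows "a \<notin> reachable (base_graph V (F - {{a, b}})) b"
proof
  let ?f = "{a, b}"
  let ?H = "base_graph V (F - {?f})"
  assume "a \<in> reachable ?H b"
  then obtain vs es where "is_walk ?H vs es" "hd vs = b" "last vs = a"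
    unfolding reachable_def by auto
  then obtain vs' es' where p: "is_walk ?H vs' es'" "hd vs' = b" "last vs' = a" "distinct vs'"
    using walk_to_path unfolding is_path_def by blast
  have sub: "is_walk (base_graph V F) vs es" if "is_walk ?H vs es" for vs es
    using that by (induction ?H vs es rule: is_walk.induct) (auto simp: base_graph_def)
  obtain zs where zs: "vs' = b # zs" using walk_nonempty[OF p(1)] p(2) by (cases vs') auto
  have "is_walk (base_graph V F) (a # vs') (?f # es')"
    using sub[OF p(1)] f ab unfolding zs by (simp add: base_graph_def)
  moreover have "?f \<notin> set es'"
    using walk_ends[OF p(1)] by (auto simp: base_graph_def)
  ultimately have "is_cycle (base_graph V F) (a # vs') (?f # es')"
    unfolding is_cycle_def using p zs walk_distinct_edges[OF p(1,4)] by simp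
  then show False using tree unfolding is_tree_def by blast
qed

lemma tree_sides_exist:
  assumes tree: "is_tree (base_graph V F)" and r: "r \<in> V"
  shows "\<exists>side. tree_sides V F r side"
proof -
  have wf: "finite V" "finite F" "\<And>f. f \<in> F \<Longrightarrow> \<exists>a\<in>V. \<exists>b\<in>V. f = {a, b}"
    using tree unfolding is_tree_def wf_multigraph_def base_graph_def by auto
  have conn: "graph_connected (base_graph V F)" using tree unfolding is_tree_def by simp
  have ends: "F' \<subseteq> {{a, b} |a b. a \<in> V \<and> b \<in> V}" if "F' \<subseteq> F" for F'
    using wf(3) that by blast
  define side where "side f = V - reachable (base_graph V (F - {f})) r" for f
  have inv: "edge_invariant (base_graph V (F - {f})) (reachable (base_graph V (F - {f})) u)" for f u
    by (rule reachable_invariant)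
  have step: "u \<in> reachable (base_graph V (F - {f})) s \<longleftrightarrow> v \<in> reachable (base_graph V (F - {f})) s"
    if "{u, v} \<in> F" "{u, v} \<noteq> f" for u v s f
    using inv[of f s] that unfolding edge_invariant_base_graph[OF ends[OF Diff_subset]] by blast
  have verts: "mverts (base_graph V F') = V" for F' by (simp add: base_graph_def)
  have in_V: "a \<in> V" "b \<in> V" if "{a, b} \<in> F" for a b
    using wf(3)[OF that] by (auto simp: doubleton_eq_iff)
  \<comment> \<open>If both ends stayed connected to the root, they would be joined without the
    edge, against \<open>tree_bridge\<close>. The case distinction on \<open>r\<close> stands in for
    the symmetry of reachability.\<close>
  have bridge: "a \<notin> reachable (base_graph V (F - {{a, b}})) r \<or> b \<notin> reachable (base_graph V (F - {{a, b}})) r"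
    if f: "{a, b} \<in> F" for a b
  proof (rule ccontr)
    let ?H = "base_graph V (F - {{a, b}})"
    assume "\<not> ?thesis"
    then have ar: "a \<in> reachable ?H r" and br: "b \<in> reachable ?H r" by simp_all
    have nb: "a \<notin> reachable ?H b" by (rule tree_bridge[OF tree f in_V[OF f]])
    show False
    proof (cases "r \<in> reachable ?H b")
      case True
      then have "reachable ?H r \<subseteq> reachable ?H b" by (rule reachable_least[OF reachable_invariant])
      then show False using ar nb by blast
    next
      case False
      have "edge_invariant ?H (V - reachable ?H b)"
        using inv[of "{a, b}" b] in_V unfolding edge_invariant_base_graph[OF ends[OF Diff_subset]] by blast
      then have "reachable ?H r \<subseteq> V - reachable ?H b"
        by (rule reachable_least) (use r False in simp)
      then show False using br reachable_refl[of b ?H] in_V[OF f] by (auto simp: verts)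
    qed
  qed
  \<comment> \<open>If neither end were reachable from the root, the reachable set would be
    invariant in the whole tree and hence all of \<open>V\<close>.\<close>
  have touch: "a \<in> reachable (base_graph V (F - {{a, b}})) r \<or> b \<in> reachable (base_graph V (F - {{a, b}})) r"
    if f: "{a, b} \<in> F" for a b
  proof (rule ccontr)
    let ?R = "reachable (base_graph V (F - {{a, b}})) r"
    assume no: "\<not> ?thesis"
    have "u \<in> ?R \<longleftrightarrow> v \<in> ?R" if "{u, v} \<in> F" for u v
    proof (cases "{u, v} = {a, b}")
      case True
      then show ?thesis using no by (auto simp: doubleton_eq_iff)
    qed (rule step[OF that])
    then have "edge_invariant (base_graph V F) ?R"
      unfolding edge_invariant_base_graph[OF ends[OF order_refl]] by blast
    moreover have "?R \<subseteq> V" using reachable_subset[of "base_graph V (F - {{a, b}})" r] by (simp add: verts)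
    ultimately have "?R = {} \<or> ?R = V"
      using conn unfolding graph_connected_iff verts by blast
    moreover have "r \<in> ?R" using reachable_refl[of r "base_graph V (F - {{a, b}})"] r by (simp add: verts)
    ultimately show False using no in_V[OF f] by blast
  qed
  have "tree_sides V F r side"
  proof
    show "r \<notin> side f" for f
      unfolding side_def using reachable_refl[of r "base_graph V (F - {f})"] r by (simp add: verts)
    show "a \<in> side f \<longleftrightarrow> b \<in> side f" if "{a, b} \<in> F" "{a, b} \<noteq> f" for a b f
      unfolding side_def using step[OF that] in_V[OF that(1)] by blast
    show "a \<in> side {a, b} \<longleftrightarrow> b \<notin> side {a, b}" if "{a, b} \<in> F" for a b
      unfolding side_def using bridge[OF that] touch[OF that] in_V[OF that] by blast
  qed (use wf conn r in \<open>auto simp: side_def\<close>)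
  then show ?thesis by blast
qed

context tree_sides
begin

lemma ends_in_V: "{a, b} \<in> F \<Longrightarrow> a \<in> V \<and> b \<in> V"
  using edge_ends by (fastforce simp: doubleton_eq_iff)

lemma edges_pairs: "F \<subseteq> {{a, b} |a b. a \<in> V \<and> b \<in> V}"
  using edge_ends by blast

lemma invariant_trivial:
  assumes "X \<subseteq> V" "\<And>a b. {a, b} \<in> F \<Longrightarrow> a \<in> X \<longleftrightarrow> b \<in> X"
  shows "X = {} \<or> X = V"
proof -
  have "edge_invariant (base_graph V F) X"
    unfolding edge_invariant_base_graph[OF edges_pairs] using assms(2) by blast
  then show ?thesis
    using connected assms(1) unfolding graph_connected_iff by (simp add: base_graph_def)
qed

lemma side_nonempty:
  assumes "f \<in> F" shows "side f \<noteq> {}"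
  using edge_ends[OF assms] side_self assms by blast

lemma sides_laminar:
  assumes f: "f \<in> F" and g: "g \<in> F"
  shows "side f \<subseteq> side g \<or> side g \<subseteq> side f \<or> side f \<inter> side g = {}"
proof (cases "f = g")
  case False
  obtain a b where ab: "f = {a, b}" "a \<in> V" using edge_ends[OF f] by blast
  obtain c d where cd: "g = {c, d}" "c \<in> V" using edge_ends[OF g] by blast
  \<comment> \<open>Of the four cells cut out by the two sides, the one touched by neither \<open>f\<close> nor \<open>g\<close> must be empty.\<close>
  define C where "C = {v \<in> V. (v \<in> side f) \<noteq> (c \<in> side f) \<and> (v \<in> side g) \<noteq> (a \<in> side g)}"
  have "u \<in> C \<longleftrightarrow> v \<in> C" if e: "{u, v} \<in> F" for u v
  proof -
    have eq_f: "u \<in> side f \<longleftrightarrow> v \<in> side f" if "{u, v} \<noteq> f"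
      using side_other[OF f e that] .
    have eq_g: "u \<in> side g \<longleftrightarrow> v \<in> side g" if "{u, v} \<noteq> g"
      using side_other[OF g e that] .
    have a_b: "a \<in> side g \<longleftrightarrow> b \<in> side g" using side_other[OF g, of a b] f ab False by simp
    have c_d: "c \<in> side f \<longleftrightarrow> d \<in> side f" using side_other[OF f, of c d] g cd False by simp
    consider "{u, v} = f" | "{u, v} = g" | "{u, v} \<noteq> f" "{u, v} \<noteq> g" by blast
    then show ?thesis
    proof cases
      case 1
      then have "(u = a \<and> v = b) \<or> (u = b \<and> v = a)" unfolding ab by (simp add: doubleton_eq_iff)
      then have "(u \<in> side g) = (a \<in> side g)" "(v \<in> side g) = (a \<in> side g)" using a_b by auto
      then show ?thesis unfolding C_def by simp
    next
      case 2
      then have "(u = c \<and> v = d) \<or> (u = d \<and> v = c)" unfolding cd by (simp add: doubleton_eq_iff)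
      then have "(u \<in> side f) = (c \<in> side f)" "(v \<in> side f) = (c \<in> side f)" using c_d by auto
      then show ?thesis unfolding C_def by simp
    next
      case 3
      then show ?thesis using eq_f eq_g ends_in_V[OF e] unfolding C_def by simp
    qed
  qed
  then have "C = {} \<or> C = V" by (intro invariant_trivial) (auto simp: C_def)
  moreover have "a \<notin> C" unfolding C_def by simp
  ultimately have "C = {}" using ab(2) by blast
  then have *: "(v \<in> side f) = (c \<in> side f) \<or> (v \<in> side g) = (a \<in> side g)" if "v \<in> V" for v
    using that unfolding C_def by blast
  \<comment> \<open>Three of the four possible empty cells give the claim. The fourth is the one
    outside both sides, and it contains the root.\<close>
  have "r \<notin> side f" "r \<notin> side g" using root_notin f g by simp_all
  then have "c \<notin> side f \<or> a \<notin> side g" using *[OF root] by blast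
  then show ?thesis
    using * side_verts[OF f] side_verts[OF g] by blast
qed simp

text \<open>Deleting \<open>f\<close> leaves exactly two components. If \<open>X\<close> separates
  the ends of \<open>f\<close>, then whether \<open>X\<close> and \<open>side f\<close> agree is the
  same at both ends of every edge, so they agree everywhere or nowhere on \<open>V\<close>.\<close>

lemma invariant_except:
  assumes f: "f \<in> F" and X: "X \<subseteq> V" "X \<noteq> {}"
    and inv: "\<And>a b. {a, b} \<in> F \<Longrightarrow> {a, b} \<noteq> f \<Longrightarrow> a \<in> X \<longleftrightarrow> b \<in> X"
  shows "X = V \<or> X = side f \<or> X = V - side f"
proof -
  obtain a b where ab: "f = {a, b}" using edge_ends[OF f] by blast
  have self: "a \<in> side f \<longleftrightarrow> b \<notin> side f" using side_self f ab by blast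
  have abV: "a \<in> V" "b \<in> V" using ends_in_V f ab by blast+
  have edge_f: "(u = a \<and> v = b) \<or> (u = b \<and> v = a)" if "{u, v} = f" for u v
    using that unfolding ab by (simp add: doubleton_eq_iff)
  show ?thesis
  proof (cases "a \<in> X \<longleftrightarrow> b \<in> X")
    case True
    have "u \<in> X \<longleftrightarrow> v \<in> X" if "{u, v} \<in> F" for u v
      using inv[OF that] edge_f[of u v] True by blast
    then show ?thesis using invariant_trivial[OF X(1)] X(2) by blast
  next
    case False
    define Z where "Z = {v \<in> V. (v \<in> X \<longleftrightarrow> v \<in> side f) \<longleftrightarrow> (a \<in> X \<longleftrightarrow> a \<in> side f)}"
    have "u \<in> Z \<longleftrightarrow> v \<in> Z" if e: "{u, v} \<in> F" for u v
    proof (cases "{u, v} = f")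
      case True
      show ?thesis using edge_f[OF True] abV False self unfolding Z_def by blast
    next
      case ne: False
      show ?thesis
        using inv[OF e ne] side_other[OF f e ne] ends_in_V[OF e] unfolding Z_def by simp
    qed
    then have "Z = {} \<or> Z = V" by (intro invariant_trivial) (auto simp: Z_def)
    moreover have "a \<in> Z" using abV unfolding Z_def by simp
    ultimately have *: "(v \<in> X \<longleftrightarrow> v \<in> side f) \<longleftrightarrow> (a \<in> X \<longleftrightarrow> a \<in> side f)" if "v \<in> V" for v
      using that unfolding Z_def by blast
    show ?thesis using * X(1) side_verts[OF f] by blast
  qed
qed

section \<open>Tree paths and 2-edge-connectivity expressed by sides\<close>

text \<open>Only the edge \<open>f\<close> changes membership in \<open>side f\<close>, and a path
  uses \<open>f\<close> at most once.\<close>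

lemma path_edges:
  assumes "is_walk (base_graph V F) vs es" "distinct vs" "f \<in> F"
  shows "f \<in> set es \<longleftrightarrow> (hd vs \<in> side f) \<noteq> (last vs \<in> side f)"
proof -
  have "is_walk G vs es \<Longrightarrow> G = base_graph V F \<Longrightarrow> distinct vs \<Longrightarrow>
      f \<in> set es \<longleftrightarrow> (hd vs \<in> side f) \<noteq> (last vs \<in> side f)" for G
  proof (induction G vs es rule: is_walk.induct)
    case (2 G v w vs e es)
    have e: "e = {v, w}" "{v, w} \<in> F" and walk: "is_walk G (w # vs) es"
      using 2(2,3) by (auto simp: base_graph_def)
    have IH: "f \<in> set es \<longleftrightarrow> (w \<in> side f) \<noteq> (last (w # vs) \<in> side f)"
      using 2 by simp
    show ?case
    proof (cases "e = f")
      case True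
      have "f \<notin> set es" using walk_distinct_edges[OF 2(2) 2(4)] True by simp
      moreover have "v \<in> side f \<longleftrightarrow> w \<notin> side f" using side_self[OF e(2)] True e(1) by simp
      ultimately show ?thesis using IH True by auto
    next
      case False
      have "v \<in> side f \<longleftrightarrow> w \<in> side f" using side_other[OF assms(3) e(2)] False e(1) by blast
      then show ?thesis using IH False by auto
    qed
  qed simp_all
  then show ?thesis using assms by blast
qed

text \<open>By \<open>path_edges\<close> the ends determine the set of edges. The first edge of one
  path thus occurs in the other, and it comes first there because the start vertex does not
  recur.\<close>

lemma path_unique:
  assumes "is_walk (base_graph V F) vs es" "distinct vs"
    and "is_walk (base_graph V F) vs' es'" "distinct vs'"
    and "hd vs = hd vs'" "last vs = last vs'"
  shows "es = es'"
  using assms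
proof (induction es arbitrary: vs vs' es')
  case Nil
  then have "last vs = hd vs" by (cases "(base_graph V F, vs, [] :: 'v set list)" rule: is_walk.cases) auto
  then have "f \<notin> set es'" if "f \<in> F" for f
    using path_edges[OF Nil(3,4) that] Nil(5,6) by simp
  moreover have "set es' \<subseteq> F" using walk_ends[OF Nil(3)] by (auto simp: base_graph_def)
  ultimately show ?case by (cases es') auto
next
  case (Cons e es)
  obtain v w ws where vs: "vs = v # w # ws"
    using Cons.prems(1) by (cases "(base_graph V F, vs, e # es)" rule: is_walk.cases) auto
  have e: "e = {v, w}" "e \<in> F" and walk: "is_walk (base_graph V F) (w # ws) es"
    using Cons.prems(1) unfolding vs by (auto simp: base_graph_def)
  have "e \<in> set es'"
    using path_edges[OF Cons.prems(1,2) e(2)] path_edges[OF Cons.prems(3,4) e(2)] Cons.prems(5,6) by simp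
  then obtain v' w' ws' e' es'' where vs': "vs' = v' # w' # ws'" "es' = e' # es''"
    using Cons.prems(3) by (cases "(base_graph V F, vs', es')" rule: is_walk.cases) auto
  have v': "v' = v" using Cons.prems(5) vs vs' by simp
  have e': "e' = {v, w'}" and walk': "is_walk (base_graph V F) (w' # ws') es''"
    using Cons.prems(3) unfolding vs' v' by (auto simp: base_graph_def)
  have "e = e'"
  proof (rule ccontr)
    assume "e \<noteq> e'"
    then have "e \<in> set es''" using \<open>e \<in> set es'\<close> vs'(2) by simp
    then have "v \<in> set (w' # ws')" using walk_ends[OF walk'] e(1) by (auto simp: base_graph_def)
    then show False using Cons.prems(4) vs'(1) v' by simp
  qed
  then have "w = w'" using e(1) e' by (auto simp: doubleton_eq_iff)
  then have "es = es''"
    using Cons.IH[OF walk _ walk'] Cons.prems vs vs' by simp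
  then show ?case using \<open>e = e'\<close> vs'(2) by simp
qed

lemma tree_path_sides:
  assumes uv: "u \<in> V" "v \<in> V" and f: "f \<in> F"
  shows "f \<in> set (tree_path V F u v) \<longleftrightarrow> (u \<in> side f) \<noteq> (v \<in> side f)"
proof -
  obtain vs es where w: "is_walk (base_graph V F) vs es" "hd vs = u" "last vs = v"
    using connected uv unfolding graph_connected_def by (auto simp: base_graph_def) blast
  obtain vs' es' where p: "is_path (base_graph V F) u vs' es' v"
    using walk_to_path[OF w(1)] w(2,3) by blast
  have "tree_path V F u v = es'"
    unfolding tree_path_def
  proof (rule the_equality)
    show "\<exists>vs. is_path (base_graph V F) u vs es' v" using p by blast
    show "es = es'" if "\<exists>vs. is_path (base_graph V F) u vs es v" for es
      using that p path_unique unfolding is_path_def by metis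
  qed
  then show ?thesis
    using path_edges[of vs' es', OF _ _ f] p unfolding is_path_def by auto
qed

text \<open>Deleting an additional edge leaves the tree intact. After deleting a tree edge
  \<open>f\<close>, only \<open>side f\<close> and its complement can be proper invariant sets, and
  a crossing edge of \<open>J\<close> rules them out.\<close>

lemma edge_connected_2_iff:
  assumes J: "J \<subseteq> V \<times> V"
  shows "edge_connected 2 (augmented_graph V F J) \<longleftrightarrow> (\<forall>f\<in>F. \<exists>j\<in>J. crosses (side f) j)"
proof
  let ?G = "augmented_graph V F J"
  have verts: "mverts (delete_edges ?G S) = V" for S
    unfolding delete_edges_def augmented_graph_def by simp
  have inv: "edge_invariant (delete_edges ?G S) X \<longleftrightarrow>
      (\<forall>a b. {a, b} \<in> F \<longrightarrow> Inl {a, b} \<notin> S \<longrightarrow> (a \<in> X \<longleftrightarrow> b \<in> X)) \<and>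
      (\<forall>a b. (a, b) \<in> J \<longrightarrow> Inr (a, b) \<notin> S \<longrightarrow> (a \<in> X \<longleftrightarrow> b \<in> X))" (is "?l \<longleftrightarrow> ?r") for S X
  proof
    assume l: ?l
    have "a \<in> X \<longleftrightarrow> b \<in> X" if "{a, b} \<in> F" "Inl {a, b} \<notin> S" for a b
      using l[unfolded edge_invariant_def verts, THEN bspec, of "Inl {a, b}"] that ends_in_V[OF that(1)]
      unfolding delete_edges_def augmented_graph_def by auto
    moreover have "a \<in> X \<longleftrightarrow> b \<in> X" if "(a, b) \<in> J" "Inr (a, b) \<notin> S" for a b
      using l[unfolded edge_invariant_def verts, THEN bspec, of "Inr (a, b)"] that J
      unfolding delete_edges_def augmented_graph_def by auto
    ultimately show ?r by blast
  next
    assume r: ?r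
    show ?l
      unfolding edge_invariant_def
    proof (intro ballI impI)
      fix e u v assume e: "e \<in> medges (delete_edges ?G S)" "mends (delete_edges ?G S) e = {u, v}"
      show "u \<in> X \<longleftrightarrow> v \<in> X"
      proof (cases e)
        case (Inl f)
        then have "f = {u, v}" "f \<in> F" "Inl f \<notin> S"
          using e unfolding delete_edges_def augmented_graph_def by auto
        then show ?thesis using r by blast
      next
        case (Inr p)
        obtain a b where p: "p = (a, b)" by fastforce
        have "{a, b} = {u, v}" "(a, b) \<in> J" "Inr (a, b) \<notin> S"
          using e Inr p unfolding delete_edges_def augmented_graph_def by auto
        moreover from this(2,3) have "a \<in> X \<longleftrightarrow> b \<in> X" using r by blast
        ultimately show ?thesis by (auto simp: doubleton_eq_iff)
      qed
    qed
  qed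
  {
    assume ec: "edge_connected 2 ?G"
    show "\<forall>f\<in>F. \<exists>j\<in>J. crosses (side f) j"
    proof (rule ballI, rule ccontr)
      fix f assume f: "f \<in> F" and no: "\<not> (\<exists>j\<in>J. crosses (side f) j)"
      have "graph_connected (delete_edges ?G {Inl f})"
        using ec[unfolded edge_connected_def, THEN spec, of "{Inl f}"] f by (auto simp: augmented_graph_def)
      moreover have "edge_invariant (delete_edges ?G {Inl f}) (side f)"
        unfolding inv using side_other[OF f] no unfolding crosses_def by fastforce
      ultimately have "side f = {} \<or> side f = V"
        using side_verts[OF f] unfolding graph_connected_iff verts by blast
      then show False using side_nonempty[OF f] root_notin[OF f] root by blast
    qed
  next
    assume cov: "\<forall>f\<in>F. \<exists>j\<in>J. crosses (side f) j"
    show "edge_connected 2 ?G"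
      unfolding edge_connected_def
    proof (intro allI impI)
      fix S assume S: "S \<subseteq> medges ?G \<and> finite S \<and> card S < 2"
      then have "card S = 0 \<or> card S = 1" by linarith
      then have S': "S = {} \<or> (\<exists>e. S = {e})" using S by (auto simp: card_1_singleton_iff)
      have "X = {} \<or> X = V" if X: "X \<subseteq> V" "edge_invariant (delete_edges ?G S) X" for X
      proof (cases "\<exists>f\<in>F. S = {Inl f}")
        case False
        then have "Inl f \<notin> S" if "f \<in> F" for f using S' that by auto
        then show ?thesis using X unfolding inv by (intro invariant_trivial) auto
      next
        case True
        then obtain f where f: "f \<in> F" "S = {Inl f}" by blast
        show ?thesis
        proof (cases "X = {}")
          case ne: False
          have "X = V \<or> X = side f \<or> X = V - side f"
            using X f(2) by (intro invariant_except[OF f(1) X(1) ne]) (auto simp: inv)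
          moreover obtain a b where "(a, b) \<in> J" "(a \<in> side f) \<noteq> (b \<in> side f)"
            using cov f(1) unfolding crosses_def by fastforce
          moreover from this have "a \<in> X \<longleftrightarrow> b \<in> X" "a \<in> V" "b \<in> V"
            using X(2) f(2) J unfolding inv by auto
          ultimately show ?thesis by blast
        qed simp
      qed
      then show "graph_connected (delete_edges ?G S)"
        unfolding graph_connected_iff verts using root by blast
    qed
  }
qed

end

section \<open>The integrality gap\<close>

lemma crosses_pair: "crosses D (u, v) \<longleftrightarrow> (u \<in> D) \<noteq> (v \<in> D)"
  by (simp add: crosses_def)

context tree_sides
begin

lemma psi_sides: "E \<subseteq> V \<times> V \<Longrightarrow> f \<in> F \<Longrightarrow> psi V F E f = {e \<in> E. crosses (side f) e}"
  unfolding psi_def using tree_path_sides by (auto simp: crosses_pair)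

lemma cover_from_lp:
  assumes E: "E \<subseteq> V \<times> V" and x: "cut_lp_feasible V F E x"
  shows "\<exists>J\<subseteq>E. (\<forall>f\<in>F. \<exists>j\<in>J. crosses (side f) j) \<and> card J \<le> 28 / 15 * (\<Sum>e\<in>E. x e)"
proof -
  have finE: "finite E" using E finite_verts finite_subset by blast
  define y where "y e = (if e \<in> E then x e else 0)" for e
  \<comment> \<open>Both orientations are merged, as \<open>E\<close> may contain either of them.
    Pairs that no side separates lie in no cut and get weight 0, as \<open>laminar_gap\<close>
    demands.\<close>
  define w where "w u v = (if \<exists>f\<in>F. (u \<in> side f) \<noteq> (v \<in> side f) then y (u, v) + y (v, u) else 0)" for u v
  have y_nonneg: "0 \<le> y e" for e
    using x unfolding y_def cut_lp_feasible_def by simp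
  have sum_y: "(\<Sum>e\<in>A. y e) = (\<Sum>e\<in>E \<inter> A. x e)" if "finite A" for A
    unfolding y_def using sum.inter_restrict[OF that, of x E] by (simp add: Int_commute)
  interpret w: weighted_links V w
    by unfold_locales (use finite_verts y_nonneg in \<open>auto simp: w_def add.commute\<close>)
  have W_y: "(\<Sum>u\<in>A. \<Sum>v\<in>B. y (u, v) + y (v, u)) = (\<Sum>e\<in>A \<times> B. y e) + (\<Sum>e\<in>B \<times> A. y e)" for A B
  proof -
    have "(\<Sum>u\<in>A. \<Sum>v\<in>B. y (v, u)) = (\<Sum>v\<in>B. \<Sum>u\<in>A. y (v, u))" by (rule sum.swap)
    then show ?thesis by (simp add: sum.distrib sum.cartesian_product')
  qed
  have cut: "1 \<le> w.W (side f) (V - side f)" if f: "f \<in> F" for f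
  proof -
    let ?D = "side f"
    have fin: "finite (?D \<times> (V - ?D))" "finite ((V - ?D) \<times> ?D)"
      using finite_verts side_verts[OF f] finite_subset by auto
    have "w.W ?D (V - ?D) = (\<Sum>u\<in>?D. \<Sum>v\<in>V - ?D. y (u, v) + y (v, u))"
      unfolding w.W_def w_def using f by (intro sum.cong refl) auto
    also have "\<dots> = (\<Sum>e\<in>E \<inter> (?D \<times> (V - ?D)). x e) + (\<Sum>e\<in>E \<inter> ((V - ?D) \<times> ?D). x e)"
      unfolding W_y sum_y[OF fin(1)] sum_y[OF fin(2)] ..
    also have "\<dots> = (\<Sum>e\<in>E \<inter> (?D \<times> (V - ?D)) \<union> E \<inter> ((V - ?D) \<times> ?D). x e)"
      by (rule sum.union_disjoint[symmetric]) (use finE in auto)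
    also have "E \<inter> (?D \<times> (V - ?D)) \<union> E \<inter> ((V - ?D) \<times> ?D) = psi V F E f"
      unfolding psi_sides[OF E f] using E by (auto simp: crosses_def)
    finally show ?thesis using x f unfolding cut_lp_feasible_def by simp
  qed
  interpret L: laminar_cuts V w "side ` F"
  proof unfold_locales
    show "D \<subseteq> V" if "D \<in> side ` F" for D using that side_verts by blast
    show "D \<subseteq> G \<or> G \<subseteq> D \<or> D \<inter> G = {}" if "D \<in> side ` F" "G \<in> side ` F" for D G
      using that sides_laminar by blast
    show "1 \<le> w.W D (V - D)" if "D \<in> side ` F" for D using that cut by blast
  qed
  have "w u v = 0" if "\<And>D. D \<in> side ` F \<Longrightarrow> u \<in> D \<longleftrightarrow> v \<in> D" for u v
    using that unfolding w_def by simp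
  from L.laminar_gap[OF this]
  obtain J where J: "J \<subseteq> w.links" "\<forall>D\<in>side ` F. \<exists>j\<in>J. crosses D j" "card J \<le> 14 / 15 * w.W V V"
    by blast
  \<comment> \<open>A link has positive weight as soon as one orientation is in \<open>E\<close>;
    \<open>g\<close> selects an orientation that is.\<close>
  define g where "g j = (if j \<in> E then j else (snd j, fst j))" for j :: "'v \<times> 'v"
  have gE: "g j \<in> E" if "j \<in> J" for j
  proof -
    have "w (fst j) (snd j) > 0" using J(1) that unfolding w.links_def by auto
    then have "y (fst j, snd j) + y (snd j, fst j) > 0" unfolding w_def by (simp split: if_splits)
    then show ?thesis unfolding g_def y_def by (auto split: if_splits)
  qed
  have crosses_g: "crosses D (g j) \<longleftrightarrow> crosses D j" for D j
    unfolding g_def crosses_def by auto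
  \<comment> \<open>This is only an inequality because some pairs got weight 0. Counting ordered
    pairs gives the factor 2 that turns 14/15 into 28/15.\<close>
  have "w.W V V \<le> (\<Sum>u\<in>V. \<Sum>v\<in>V. y (u, v) + y (v, u))"
    unfolding w.W_def by (intro sum_mono) (simp add: w_def y_nonneg)
  also have "\<dots> = 2 * (\<Sum>e\<in>E. x e)"
    unfolding W_y using sum_y[of "V \<times> V"] finite_verts E by (simp add: Int_absorb2)
  finally have "card J \<le> 28 / 15 * (\<Sum>e\<in>E. x e)" using J(3) by simp
  moreover have "card (g ` J) \<le> card J"
    by (rule card_image_le) (rule finite_subset[OF J(1) w.finite_links])
  ultimately have "card (g ` J) \<le> 28 / 15 * (\<Sum>e\<in>E. x e)" by simp
  moreover have "\<forall>f\<in>F. \<exists>j\<in>g ` J. crosses (side f) j"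
    using J(2) crosses_g by blast
  moreover have "g ` J \<subseteq> E" using gE by blast
  ultimately show ?thesis by blast
qed

end

theorem theorem2:
  fixes V :: "'v set" and F :: "'v set set" and E :: "('v \<times> 'v) set"
  assumes "tap_instance V F E"
    and "tap_feasible V F E"
  shows "real (tap_opt V F E) \<le> 28 / 15 * cut_lp_value V F E"
proof -
  have tree: "is_tree (base_graph V F)" and E: "E \<subseteq> V \<times> V"
    using assms(1) unfolding tap_instance_def by simp_all
  obtain r where "r \<in> V"
    using tree unfolding is_tree_def graph_connected_def base_graph_def by auto
  then obtain side where "tree_sides V F r side"
    using tree_sides_exist[OF tree] by blast
  then interpret tree_sides V F r side .
  have finE: "finite E" using E finite_verts finite_subset by blast
  have solutions: "tap_solutions V F E = {J. J \<subseteq> E \<and> (\<forall>f\<in>F. \<exists>j\<in>J. crosses (side f) j)}"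
    unfolding tap_solutions_def using edge_connected_2_iff E by blast
  have fin: "finite (card ` tap_solutions V F E)"
    unfolding solutions using finE by simp
  have "15 / 28 * real (tap_opt V F E) \<le> (\<Sum>e\<in>E. x e)" if x: "cut_lp_feasible V F E x" for x
  proof -
    obtain J where J: "J \<subseteq> E" "\<forall>f\<in>F. \<exists>j\<in>J. crosses (side f) j" "card J \<le> 28 / 15 * (\<Sum>e\<in>E. x e)"
      using cover_from_lp[OF E x] by blast
    have "tap_opt V F E \<le> card J"
      unfolding tap_opt_def using fin J(1,2) by (intro Min_le) (auto simp: solutions)
    then show ?thesis using J(3) by simp
  qed
  \<comment> \<open>A lower bound passes to the infimum only for a nonempty set of values. The
    constant 1 is feasible, since a solution of the instance makes every \<open>psi V F E f\<close>
    nonempty.\<close>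
  moreover have "cut_lp_feasible V F E (\<lambda>_. 1)"
  proof -
    have "1 \<le> card (psi V F E f)" if f: "f \<in> F" for f
    proof -
      obtain J where "J \<subseteq> E" "\<exists>j\<in>J. crosses (side f) j"
        using assms(2) f unfolding tap_feasible_def solutions by blast
      then have "psi V F E f \<noteq> {}" unfolding psi_sides[OF E f] by blast
      moreover have "finite (psi V F E f)" unfolding psi_sides[OF E f] using finE by simp
      ultimately show ?thesis by (simp add: Suc_le_eq card_gt_0_iff)
    qed
    then show ?thesis unfolding cut_lp_feasible_def by simp
  qed
  ultimately have "15 / 28 * real (tap_opt V F E) \<le> cut_lp_value V F E"
    unfolding cut_lp_value_def by (intro cInf_greatest) auto
  then show ?thesis by simp
qed

end
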